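(* Let $\lambda>0$, let $\pi^0\in\Pi_\mu$, and let $(\pi^n)_{n\in\mathbb N_0}\subset\Pi_\mu$ be given by $$\pi^{n+1}(\cdot|s)=\underset{m\in\mathcal P(A)}{\arg\min}\left(\int_A\frac{\delta V^{\pi^n}_\tau}{\delta\pi}(s,a)\,(m(da)-\pi^n(da|s))+\lambda\,\mathrm{KL}(m|\pi^n(\cdot|s))\right),\qquad s\in S,\ n\in\mathbb N_0 .$$ (i) For all $\rho\in\mathcal P(S)$, $\lambda\ge\tau$ and $n\in\mathbb N$ with $n\ge1$, $$0\le V^{\pi^n}_\tau(\rho)-V^*_\tau(\rho)\le\frac1{1-\gamma}\bigg(\lambda\int_S\mathrm{KL}(\pi^*_\tau(\cdot|s)|\pi^0(\cdot|s))\,d^{\pi^*_\tau}_\rho(ds)+\int_S(V^{\pi^0}_\tau-V^*_\tau)(s)\,d^{\pi^*_\tau}_\rho(ds)\bigg)\frac1n .$$ (ii) Assume in addition that $d^{\pi^*_\tau}_\rho\ll\rho$ and $\xi:=(1-\gamma)^{-1}\Big\|\frac{\mathrm d d^{\pi^*_\tau}_\rho}{\mathrm d\rho}\Big\|_{B_b(S)}<\infty$. Then for all $\tau\le\lambda\le\xi\tau$ and $n\in\mathbb N_0$, $$V^{\pi^n}_\tau(\rho)-V^*_\tau(\rho)+\frac{\lambda}{(1-\gamma)\xi}\int_S\mathrm{KL}(\pi^*_\tau(\cdot|s)|\pi^n(\cdot|s))\,d^{\pi^*_\tau}_\rho(ds)\le\Big(\frac{\xi-1}{\xi}\Big)^n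\bigg(V^{\pi^0}_\tau(\rho)-V^*_\tau(\rho)+\frac{\lambda}{(1-\gamma)\xi}\int_S\mathrm{KL}(\pi^*_\tau(\cdot|s)|\pi^0(\cdot|s))\,d^{\pi^*_\tau}_\rho(ds)\bigg).$$
   Context: $S,A$ are Polish spaces (with Borel $\sigma$-algebras), $P$ is a probability kernel from $S\times A$ to $S$ (written $P(ds'|s,a)$), $c:S\times A\to\mathbb R$ is bounded measurable, $\gamma\in[0,1)$, $\mu\in\mathcal P(A)$, $\tau\in(0,\infty)$. $\mathcal P(E)$: Borel probability measures; $B_b(E)$: bounded measurable real functions with sup norm. $\mathrm{KL}(m|m')=\int\ln\frac{\mathrm dm}{\mathrm dm'}\,dm$ if $m\ll m'$, and $+\infty$ otherwise. $\mathbb N_0=\mathbb N\cup\{0\}$. For $f\in B_b(S\times A)$ put $\boldsymbol\pi(f)(da|s)=\frac{e^{f(s,a)}}{\int_A e^{f(s,a')}\mu(da')}\mu(da)$, and $\Pi_\mu=\{\boldsymbol\pi(f): f\in B_b(S\times A)\}$. For $\pi\in\Pi_\mu$, $\frac{\mathrm d\pi}{\mathrm d\mu}(a|s)$ is the density of $\pi(\cdot|s)$ with respect to $\mu$ (for $\pi=\boldsymbol\pi(f)$ it is $e^{f(s,a)}/\int_A e^{f(s,a')}\mu(da')$). General policies: $\Pi$ is the set of sequences $\pi=\{\pi_n\}_{n\ge0}$, $\pi_n$ a probability kernel from $H_n=(S\times A)^n\times S$ to $A$. For $\pi\in\Pi$, $\mathbb E^\pi_s$ is expectation under the law of $(s_0,a_0,s_1,a_1,\dots)$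 with $s_0=s$, $a_n\sim\pi_n(\cdot|h_n)$ given $h_n=(s_0,a_0,\dots,a_{n-1},s_n)$, and $s_{n+1}\sim P(\cdot|s_n,a_n)$. $V^\pi_\tau(s)=\mathbb E^\pi_s\big[\sum_{n\ge0}\gamma^n\big(c(s_n,a_n)+\tau\,\mathrm{KL}(\pi_n(\cdot|h_n)|\mu)\big)\big]\in\mathbb R\cup\{\infty\}$. Elements of $\Pi_\mu$ are identified with stationary policies. For $\pi\in\Pi_\mu$: $Q^\pi_\tau(s,a)=c(s,a)+\gamma\int_SV^\pi_\tau(s')P(ds'|s,a)$, and $\frac{\delta V^\pi_\tau}{\delta\pi}(s,a)=Q^\pi_\tau(s,a)+\tau\ln\frac{\mathrm d\pi}{\mathrm d\mu}(a|s)-V^\pi_\tau(s)$. Optimal quantities: $V^*_\tau(s)=\inf_{\pi\in\Pi}V^\pi_\tau(s)$ (in $B_b(S)$), $Q^*_\tau(s,a)=c(s,a)+\gamma\int_SV^*_\tau(s')P(ds'|s,a)$, $\pi^*_\tau(da|s)=\exp\big(-\tfrac1\tau(Q^*_\tau(s,a)-V^*_\tau(s))\big)\mu(da)\in\Pi_\mu$ is the optimal policy. For a function $V$ on $S$ and $\rho\in\mathcal P(S)$, $V(\rho)=\int_SV\,d\rho$. With $P_\pi(ds'|s)=\int_AP(ds'|s,a)\pi(da|s)$ and $P^n_\pi$ its $n$-fold product ($P^0_\pi(\cdot|s)=\delta_s$), $d^\pi(ds'|s)=(1-\gamma)\sum_{n\ge0}\gamma^nP^n_\pi(ds'|s)$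 and $d^\pi_\rho(ds)=\int_Sd^\pi(ds|s')\rho(ds')$. *)

theory Defs
  imports "HOL-Probability.Probability"
begin

text \<open>
  \<open>S\<close> and \<open>A\<close> are types \<open>'s, 'a\<close> of class \<^class>\<open>polish_space\<close> with their Borel sigma-algebras.
  The kernel \<open>P(ds'|s,a)\<close> is \<open>P (s, a)\<close>, and a kernel \<open>\<pi>(da|s)\<close> is \<open>\<pi> s\<close>.
  Quantities that can a priori be infinite are kept in \<^typ>\<open>ereal\<close>.
\<close>

definition Prob :: "'e::topological_space measure set" where
  "Prob = space (prob_algebra borel)"

definition Bb :: "('e::topological_space \<Rightarrow> real) set" where
  "Bb = {f \<in> borel_measurable borel. bounded (range f)}"

definition sup_norm :: "('e \<Rightarrow> real) \<Rightarrow> real" where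
  "sup_norm f = (SUP x. \<bar>f x\<bar>)"

text \<open>Integral of an extended real function as positive minus negative part
  (\<^const>\<open>e2ennreal\<close> sends negative numbers to 0), with \<open>\<infinity> - \<infinity> = \<infinity>\<close>.\<close>

definition eintegral :: "'e measure \<Rightarrow> ('e \<Rightarrow> ereal) \<Rightarrow> ereal" where
  "eintegral M f =
     enn2ereal (\<integral>\<^sup>+x. e2ennreal (f x) \<partial>M) - enn2ereal (\<integral>\<^sup>+x. e2ennreal (- f x) \<partial>M)"

text \<open>\<open>KL m m'\<close> is \<open>KL(m|m')\<close>. The library's \<^const>\<open>KL_divergence\<close> is real-valued, so it cannot
  express the value \<open>\<infinity>\<close>.\<close>

definition KL :: "'e measure \<Rightarrow> 'e measure \<Rightarrow> ereal" where
  "KL m m' =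
     (if absolutely_continuous m' m
      then eintegral m (\<lambda>x. ereal (ln (enn2real (RN_deriv m' m x)))) else \<infinity>)"

definition gibbs :: "'a::topological_space measure \<Rightarrow> ('s \<times> 'a \<Rightarrow> real) \<Rightarrow> 's \<Rightarrow> 'a measure" where
  "gibbs \<mu> f s =
     density \<mu> (\<lambda>a. ennreal (exp (f (s, a)) / (\<integral>a'. exp (f (s, a')) \<partial>\<mu>)))"

definition Pi_mu :: "'a::topological_space measure \<Rightarrow> ('s::topological_space \<Rightarrow> 'a measure) set" where
  "Pi_mu \<mu> = gibbs \<mu> ` Bb"


subsection \<open>General policies and their value\<close>

text \<open>A history \<open>h\<^sub>n = (s\<^sub>0, a\<^sub>0, \<dots>, a\<^bsub>n-1\<^esub>, s\<^sub>n)\<close> is encoded as \<open>(\<omega>, s\<^sub>n)\<close> with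
  \<open>\<omega> i = (s\<^sub>i, a\<^sub>i)\<close> for \<open>i < n\<close> and \<open>\<omega>\<close> undefined elsewhere.\<close>

definition hist_space ::
  "nat \<Rightarrow> ((nat \<Rightarrow> 's::topological_space \<times> 'a::topological_space) \<times> 's) measure" where
  "hist_space n = PiM {0..<n} (\<lambda>_. borel) \<Otimes>\<^sub>M borel"

definition policies ::
  "(nat \<Rightarrow> (nat \<Rightarrow> 's::topological_space \<times> 'a::topological_space) \<times> 's \<Rightarrow> 'a measure) set" where
  "policies = {\<pi>. \<forall>n. \<pi> n \<in> hist_space n \<rightarrow>\<^sub>M prob_algebra borel}"

definition stationary :: "('s \<Rightarrow> 'a measure) \<Rightarrow> nat \<Rightarrow> (nat \<Rightarrow> 's \<times> 'a) \<times> 's \<Rightarrow> 'a measure" where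
  "stationary \<pi> = (\<lambda>n (\<omega>, s). \<pi> s)"

text \<open>Conditional law of \<open>(s\<^sub>n, a\<^sub>n)\<close> given \<open>(s\<^sub>i, a\<^sub>i) = \<omega> i\<close> for \<open>i < n\<close>.\<close>

definition step_kernel ::
  "('s::topological_space \<times> 'a::topological_space \<Rightarrow> 's measure) \<Rightarrow>
   (nat \<Rightarrow> (nat \<Rightarrow> 's \<times> 'a) \<times> 's \<Rightarrow> 'a measure) \<Rightarrow> 's \<Rightarrow>
   nat \<Rightarrow> (nat \<Rightarrow> 's \<times> 'a) \<Rightarrow> ('s \<times> 'a) measure" where
  "step_kernel P \<pi> s n \<omega> =
     (case n of 0 \<Rightarrow> return borel s | Suc k \<Rightarrow> P (\<omega> k)) \<bind>
       (\<lambda>s'. \<pi> n (\<omega>, s') \<bind> (\<lambda>a'. return borel (s', a')))"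

text \<open>The Ionescu-Tulcea law of \<open>(s\<^sub>n, a\<^sub>n)\<^sub>n\<close> started from \<open>s\<^sub>0 = s\<close>; the locale assumptions behind the
  library constants hold by \<open>Ionescu_Tulcea_step_kernel\<close> below.\<close>

definition traj ::
  "('s::topological_space \<times> 'a::topological_space \<Rightarrow> 's measure) \<Rightarrow>
   (nat \<Rightarrow> (nat \<Rightarrow> 's \<times> 'a) \<times> 's \<Rightarrow> 'a measure) \<Rightarrow> 's \<Rightarrow> (nat \<Rightarrow> 's \<times> 'a) measure" where
  "traj P \<pi> s =
     projective_family.lim UNIV (Ionescu_Tulcea.CI (step_kernel P \<pi> s) (\<lambda>_. borel)) (\<lambda>_. borel)"

definition V ::
  "('s::topological_space \<times> 'a::topological_space \<Rightarrow> 's measure) \<Rightarrow> ('s \<times> 'a \<Rightarrow> real) \<Rightarrow> real \<Rightarrow>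
   'a measure \<Rightarrow> real \<Rightarrow> (nat \<Rightarrow> (nat \<Rightarrow> 's \<times> 'a) \<times> 's \<Rightarrow> 'a measure) \<Rightarrow> 's \<Rightarrow> ereal" where
  "V P c \<gamma> \<mu> \<tau> \<pi> s =
     eintegral (traj P \<pi> s)
       (\<lambda>\<omega>. \<Sum>n. ereal (\<gamma> ^ n) *
          (ereal (c (\<omega> n)) + ereal \<tau> * KL (\<pi> n (restrict \<omega> {0..<n}, fst (\<omega> n))) \<mu>))"


subsection \<open>State-action values, flat derivative, optimal quantities\<close>

definition bellman_Q ::
  "('s \<times> 'a \<Rightarrow> 's measure) \<Rightarrow> ('s \<times> 'a \<Rightarrow> real) \<Rightarrow> real \<Rightarrow> ('s \<Rightarrow> ereal) \<Rightarrow> 's \<times> 'a \<Rightarrow> ereal" where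
  "bellman_Q P c \<gamma> v x = ereal (c x) + ereal \<gamma> * eintegral (P x) v"

abbreviation V_stat where
  "V_stat P c \<gamma> \<mu> \<tau> \<pi> \<equiv> V P c \<gamma> \<mu> \<tau> (stationary \<pi>)"

text \<open>\<open>d\<pi>/d\<mu>(\<cdot>|s)\<close> is a version fixed up to a \<open>\<mu>\<close>-null set for each \<open>s\<close>. The choice does not matter in
  the mirror descent objective: there \<open>KL m (\<pi> s) = \<infinity>\<close> unless \<open>m \<lless> \<pi> s \<lless> \<mu>\<close>, and in
  \<^typ>\<open>ereal\<close> adding \<open>\<infinity>\<close> yields \<open>\<infinity>\<close> even for the summand \<open>-\<infinity>\<close>.\<close>

definition dV ::
  "('s::topological_space \<times> 'a::topological_space \<Rightarrow> 's measure) \<Rightarrow> ('s \<times> 'a \<Rightarrow> real) \<Rightarrow> real \<Rightarrow>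
   'a measure \<Rightarrow> real \<Rightarrow> ('s \<Rightarrow> 'a measure) \<Rightarrow> 's \<Rightarrow> 'a \<Rightarrow> ereal" where
  "dV P c \<gamma> \<mu> \<tau> \<pi> s a =
     bellman_Q P c \<gamma> (V_stat P c \<gamma> \<mu> \<tau> \<pi>) (s, a)
       + ereal (\<tau> * ln (enn2real (RN_deriv \<mu> (\<pi> s) a))) - V_stat P c \<gamma> \<mu> \<tau> \<pi> s"

text \<open>\<open>\<eta>\<close> is the step-size parameter usually written with the letter reserved here for abstraction.\<close>

definition mirror_objective ::
  "('s::topological_space \<times> 'a::topological_space \<Rightarrow> 's measure) \<Rightarrow> ('s \<times> 'a \<Rightarrow> real) \<Rightarrow> real \<Rightarrow>
   'a measure \<Rightarrow> real \<Rightarrow> real \<Rightarrow> ('s \<Rightarrow> 'a measure) \<Rightarrow> 's \<Rightarrow> 'a measure \<Rightarrow> ereal" where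
  "mirror_objective P c \<gamma> \<mu> \<tau> \<eta> \<pi> s m =
     (eintegral m (dV P c \<gamma> \<mu> \<tau> \<pi> s) - eintegral (\<pi> s) (dV P c \<gamma> \<mu> \<tau> \<pi> s))
       + ereal \<eta> * KL m (\<pi> s)"

definition V_opt ::
  "('s::topological_space \<times> 'a::topological_space \<Rightarrow> 's measure) \<Rightarrow> ('s \<times> 'a \<Rightarrow> real) \<Rightarrow> real \<Rightarrow>
   'a measure \<Rightarrow> real \<Rightarrow> 's \<Rightarrow> ereal" where
  "V_opt P c \<gamma> \<mu> \<tau> s = (INF \<pi>\<in>policies. V P c \<gamma> \<mu> \<tau> \<pi> s)"

definition Q_opt ::
  "('s::topological_space \<times> 'a::topological_space \<Rightarrow> 's measure) \<Rightarrow> ('s \<times> 'a \<Rightarrow> real) \<Rightarrow> real \<Rightarrow>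
   'a measure \<Rightarrow> real \<Rightarrow> 's \<times> 'a \<Rightarrow> ereal" where
  "Q_opt P c \<gamma> \<mu> \<tau> = bellman_Q P c \<gamma> (V_opt P c \<gamma> \<mu> \<tau>)"

definition pi_opt ::
  "('s::topological_space \<times> 'a::topological_space \<Rightarrow> 's measure) \<Rightarrow> ('s \<times> 'a \<Rightarrow> real) \<Rightarrow> real \<Rightarrow>
   'a measure \<Rightarrow> real \<Rightarrow> 's \<Rightarrow> 'a measure" where
  "pi_opt P c \<gamma> \<mu> \<tau> s =
     density \<mu> (\<lambda>a. ennreal (exp (- (1 / \<tau>) *
       real_of_ereal (Q_opt P c \<gamma> \<mu> \<tau> (s, a) - V_opt P c \<gamma> \<mu> \<tau> s))))"


subsection \<open>Occupancy measures\<close>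

definition P_pol ::
  "('s \<times> 'a \<Rightarrow> 's measure) \<Rightarrow> ('s \<Rightarrow> 'a measure) \<Rightarrow> 's \<Rightarrow> 's measure" where
  "P_pol P \<pi> s = \<pi> s \<bind> (\<lambda>a. P (s, a))"

primrec P_pol_pow ::
  "('s::topological_space \<times> 'a \<Rightarrow> 's measure) \<Rightarrow> ('s \<Rightarrow> 'a measure) \<Rightarrow> nat \<Rightarrow> 's \<Rightarrow> 's measure" where
  "P_pol_pow P \<pi> 0 s = return borel s"
| "P_pol_pow P \<pi> (Suc n) s = P_pol_pow P \<pi> n s \<bind> P_pol P \<pi>"

definition occ ::
  "('s::topological_space \<times> 'a \<Rightarrow> 's measure) \<Rightarrow> real \<Rightarrow> ('s \<Rightarrow> 'a measure) \<Rightarrow> 's \<Rightarrow> 's measure" where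
  "occ P \<gamma> \<pi> s =
     measure_of UNIV (sets borel)
       (\<lambda>B. ennreal (1 - \<gamma>) * (\<Sum>n. ennreal (\<gamma> ^ n) * emeasure (P_pol_pow P \<pi> n s) B))"

definition occ_init ::
  "('s::topological_space \<times> 'a \<Rightarrow> 's measure) \<Rightarrow> real \<Rightarrow> ('s \<Rightarrow> 'a measure) \<Rightarrow> 's measure \<Rightarrow> 's measure" where
  "occ_init P \<gamma> \<pi> \<rho> = \<rho> \<bind> occ P \<gamma> \<pi>"


subsection \<open>Well-definedness of the trajectory law\<close>

lemma Ionescu_Tulcea_step_kernel:
  fixes P :: "'s::polish_space \<times> 'a::polish_space \<Rightarrow> 's measure"
  assumes P: "P \<in> borel \<rightarrow>\<^sub>M prob_algebra borel" and \<pi>: "\<pi> \<in> policies"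
  shows "Ionescu_Tulcea (step_kernel P \<pi> s) (\<lambda>_. borel)"
proof -
  have *: "step_kernel P \<pi> s n \<in> PiM {0..<n} (\<lambda>_. borel) \<rightarrow>\<^sub>M prob_algebra borel" for n
  proof -
    have \<pi>n [measurable]: "\<pi> n \<in> PiM {0..<n} (\<lambda>_. borel) \<Otimes>\<^sub>M borel \<rightarrow>\<^sub>M prob_algebra borel"
      using \<pi> by (simp add: policies_def hist_space_def)
    note P [measurable]
    have a: "(\<lambda>\<omega>. case n of 0 \<Rightarrow> return borel s | Suc k \<Rightarrow> P (\<omega> k))
        \<in> PiM {0..<n} (\<lambda>_. borel) \<rightarrow>\<^sub>M prob_algebra borel"
      by (cases n) (auto simp: space_prob_algebra prob_space_return)
    have r: "(\<lambda>x. return borel (snd (fst x), snd x))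
        \<in> (PiM {0..<n} (\<lambda>_. borel :: ('s \<times> 'a) measure) \<Otimes>\<^sub>M (borel :: 's measure)) \<Otimes>\<^sub>M (borel :: 'a measure)
           \<rightarrow>\<^sub>M prob_algebra borel"
      unfolding borel_prod[symmetric] by measurable
    have b: "(\<lambda>(\<omega>, s'). \<pi> n (\<omega>, s') \<bind> (\<lambda>a'. return borel (s', a')))
        \<in> PiM {0..<n} (\<lambda>_. borel) \<Otimes>\<^sub>M borel \<rightarrow>\<^sub>M prob_algebra borel"
      using measurable_bind_prob_space2[OF \<pi>n, of "\<lambda>x a'. return borel (snd x, a')"] r
      by (simp add: case_prod_beta')
    show ?thesis
      unfolding step_kernel_def
      using measurable_bind_prob_space2[OF a] b by simp
  qed
  have "prob_space (step_kernel P \<pi> s n \<omega>)"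
    if "\<omega> \<in> space (PiM {0..<n} (\<lambda>_. borel :: ('s \<times> 'a) measure))" for n \<omega>
    using measurable_space[OF * that] by (simp add: space_prob_algebra)
  then show ?thesis
    by (intro Ionescu_Tulcea.intro measurable_prob_algebraD[OF *])
qed

end

theory Submission
  imports Defs
begin

text \<open>
  Policies in \<open>\<Pi>\<^sub>\<mu>\<close> are handled through their bounded normalised log-densities \<open>l\<close> with respect to \<open>\<mu>\<close>.
  Values of stationary policies and the optimal value are fixed points of contractions on bounded functions.
  For any history-dependent policy and any bounded \<open>U\<close>, the discounted sum of
  \<open>c(s\<^sub>n, a\<^sub>n) + U(s\<^sub>n) - \<integral> Q\<^sub>U(s\<^sub>n, a) \<pi>\<^sub>n(da|h\<^sub>n)\<close> telescopes in expectation to \<open>U(s)\<close>. This identifies the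
  value of a stationary policy, and together with the Gibbs variational inequality it shows that the soft
  Bellman fixed point is a lower bound for every policy; the map \<open>h \<mapsto> KL(\<pi>\<^sub>n(h)|\<mu>)\<close> need not be known to be
  measurable for this.

  The mirror step multiplies the density by \<open>exp (- \<delta>V/\<eta>)\<close> and renormalises; minus \<open>\<eta>\<close> times the logarithm of the
  normalising constant is a function \<open>g\<^sub>n(s) \<le> 0\<close>. The performance difference identity, applied to consecutive iterates, gives
  \<open>V\<^bsub>n+1\<^esub> - V\<^sub>n \<le> g\<^sub>n \<le> 0\<close> and, applied to the optimal policy,
  \<open>(1 - \<gamma>) (V\<^sup>* - V\<^sub>n)(\<rho>) = \<integral> (g\<^sub>n + \<eta> KL(\<pi>\<^sup>*|\<pi>\<^bsub>n+1\<^esub>) - (\<eta> - \<tau>) KL(\<pi>\<^sup>*|\<pi>\<^sub>n)) dd\<close>. Summing over \<open>n\<close> gives the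
  sublinear rate, and bounding the density of \<open>d\<close> by \<open>(1 - \<gamma>) \<xi>\<close> gives the linear one.
\<close>

subsection \<open>Bounded functions, integrals and relative entropy\<close>

lemma Bb_iff: "f \<in> Bb \<longleftrightarrow> f \<in> borel_measurable borel \<and> (\<exists>B. \<forall>x. \<bar>f x\<bar> \<le> B)"
  by (auto simp: Bb_def bounded_iff)

lemma BbI: "f \<in> borel_measurable borel \<Longrightarrow> (\<And>x. \<bar>f x\<bar> \<le> B) \<Longrightarrow> f \<in> Bb"
  by (auto simp: Bb_iff)

lemma Bb_measurable: "f \<in> Bb \<Longrightarrow> f \<in> borel_measurable borel"
  by (simp add: Bb_iff)

lemma Bb_boundE:
  assumes "f \<in> Bb" obtains B where "0 \<le> B" "\<And>x. \<bar>f x\<bar> \<le> B"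
  using assms unfolding Bb_iff by (metis abs_ge_zero order.trans)

lemma Bb_const: "(\<lambda>_. k) \<in> Bb"
  by (auto simp: Bb_iff)

lemma Bb_add: "f \<in> Bb \<Longrightarrow> g \<in> Bb \<Longrightarrow> (\<lambda>x. f x + g x) \<in> Bb"
  and Bb_diff: "f \<in> Bb \<Longrightarrow> g \<in> Bb \<Longrightarrow> (\<lambda>x. f x - g x) \<in> Bb"
  and Bb_mult: "f \<in> Bb \<Longrightarrow> g \<in> Bb \<Longrightarrow> (\<lambda>x. f x * g x) \<in> Bb"
proof -
  assume fg: "f \<in> Bb" "g \<in> Bb"
  obtain A where A: "0 \<le> A" "\<And>x. \<bar>f x\<bar> \<le> A" using fg(1) by (rule Bb_boundE) blast
  obtain B where B: "0 \<le> B" "\<And>x. \<bar>g x\<bar> \<le> B" using fg(2) by (rule Bb_boundE) blast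
  note [measurable] = fg[THEN Bb_measurable]
  show "(\<lambda>x. f x + g x) \<in> Bb"
    using A(2) B(2) by (intro BbI[of _ "A + B"]) (auto intro!: order.trans[OF abs_triangle_ineq] add_mono)
  show "(\<lambda>x. f x - g x) \<in> Bb"
    using A(2) B(2) by (intro BbI[of _ "A + B"]) (auto intro!: order.trans[OF abs_triangle_ineq4] add_mono)
  show "(\<lambda>x. f x * g x) \<in> Bb"
    using A B by (intro BbI[of _ "A * B"]) (auto simp: abs_mult intro!: mult_mono)
qed

lemma Bb_cmult: "f \<in> Bb \<Longrightarrow> (\<lambda>x. k * f x) \<in> Bb"
  by (intro Bb_mult Bb_const)

lemma Bb_exp:
  assumes f: "f \<in> Bb"
  shows "(\<lambda>x. exp (f x)) \<in> Bb"
proof -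
  obtain B where B: "\<And>x. \<bar>f x\<bar> \<le> B" using f by (rule Bb_boundE) blast
  note [measurable] = f[THEN Bb_measurable]
  have "f x \<le> B" for x using B[of x] by linarith
  then show ?thesis by (intro BbI[of _ "exp B"]) auto
qed

lemma Bb_fst: "f \<in> Bb \<Longrightarrow> (\<lambda>x :: _ :: second_countable_topology \<times> _ :: second_countable_topology. f (fst x)) \<in> Bb"
  unfolding Bb_iff borel_prod[symmetric] by auto

lemma Bb_Pair:
  fixes f :: "_ :: second_countable_topology \<times> _ :: second_countable_topology \<Rightarrow> real"
  shows "f \<in> Bb \<Longrightarrow> (\<lambda>a. f (s, a)) \<in> Bb"
  unfolding Bb_iff borel_prod[symmetric] by auto

lemmas Bb_intros = Bb_const Bb_add Bb_diff Bb_mult Bb_cmult Bb_exp Bb_fst Bb_Pair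

lemma Bb_integrable:
  assumes "f \<in> Bb" "finite_measure M" "sets M = sets borel"
  shows "integrable M f"
proof -
  interpret finite_measure M by fact
  obtain B where "\<And>x. \<bar>f x\<bar> \<le> B" using assms(1) by (rule Bb_boundE) blast
  then show ?thesis
    using Bb_measurable[OF assms(1)] assms(3)
    by (intro integrable_const_bound[of _ B]) (auto cong: measurable_cong_sets)
qed

section \<open>Integration against Borel probability measures and kernels\<close>

lemma ProbD: "m \<in> Prob \<Longrightarrow> sets m = sets borel" "m \<in> Prob \<Longrightarrow> prob_space m"
  by (auto simp: Prob_def space_prob_algebra)

lemma ProbI: "sets m = sets borel \<Longrightarrow> prob_space m \<Longrightarrow> m \<in> Prob"
  by (auto simp: Prob_def space_prob_algebra)

lemma Prob_integrable: "m \<in> Prob \<Longrightarrow> f \<in> Bb \<Longrightarrow> integrable m f"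
  using Bb_integrable[of f m] ProbD[of m] prob_space.finite_measure by blast

lemma Prob_kernel: "K \<in> N \<rightarrow>\<^sub>M prob_algebra borel \<Longrightarrow> x \<in> space N \<Longrightarrow> K x \<in> Prob"
  unfolding Prob_def by (rule measurable_space)

lemma Prob_integral_bound:
  assumes "m \<in> Prob" "\<And>x. \<bar>f x :: real\<bar> \<le> B"
  shows "\<bar>\<integral>x. f x \<partial>m\<bar> \<le> B"
proof -
  interpret prob_space m using assms(1) by (rule ProbD)
  have "\<bar>\<integral>x. f x \<partial>m\<bar> \<le> (\<integral>x. B \<partial>m)"
  proof (cases "integrable m f")
    case True
    then show ?thesis using assms(2)
      by (intro order.trans[OF integral_abs_bound integral_mono]) auto
  next
    \<comment> \<open>A non-integrable function has Bochner integral 0, and the bound at any point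
      gives \<open>0 \<le> B\<close>.\<close>
    case False
    then show ?thesis using assms(2)[of undefined] by (auto simp: not_integrable_integral_eq prob_space)
  qed
  then show ?thesis by (simp add: prob_space)
qed

lemma Prob_integral_diff:
  "m \<in> Prob \<Longrightarrow> f \<in> Bb \<Longrightarrow> g \<in> Bb \<Longrightarrow> (\<integral>x. f x - g x \<partial>m) = (\<integral>x. f x \<partial>m) - (\<integral>x. g x \<partial>m)"
  and Prob_integral_add:
  "m \<in> Prob \<Longrightarrow> f \<in> Bb \<Longrightarrow> g \<in> Bb \<Longrightarrow> (\<integral>x. f x + g x \<partial>m) = (\<integral>x. f x \<partial>m) + (\<integral>x. g x \<partial>m)"
  and Prob_integral_mono:
  "m \<in> Prob \<Longrightarrow> f \<in> Bb \<Longrightarrow> g \<in> Bb \<Longrightarrow> (\<And>x. f x \<le> g x) \<Longrightarrow> (\<integral>x. f x \<partial>m) \<le> (\<integral>x. g x \<partial>m)"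
  by (simp_all add: Prob_integrable integral_mono)

lemma Prob_integral_const: "m \<in> Prob \<Longrightarrow> (\<integral>x. k \<partial>m) = (k :: real)"
  by (drule ProbD(2)) (simp add: prob_space.prob_space)

text \<open>Pushing \<open>K x\<close> forward along \<open>Pair x\<close> moves the dependence on
  \<open>x\<close> from the integrand into the measure; the integral of the fixed \<open>f\<close>
  against a measurable family of measures is measurable in \<open>x\<close>.\<close>

lemma borel_measurable_integral_kernel:
  fixes f :: "'n \<times> 'e \<Rightarrow> real"
  assumes K: "K \<in> N \<rightarrow>\<^sub>M prob_algebra E" and f: "f \<in> borel_measurable (N \<Otimes>\<^sub>M E)"
  shows "(\<lambda>x. \<integral>y. f (x, y) \<partial>K x) \<in> borel_measurable N"
proof -
  note [measurable] = measurable_prob_algebraD[OF K]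
  have "(\<lambda>x. \<integral>z. f z \<partial>distr (K x) (N \<Otimes>\<^sub>M E) (Pair x)) \<in> borel_measurable N"
    by (rule measurable_compose[OF _ integral_measurable_subprob_algebra[OF f]])
       (rule measurable_distr2[where M=E], auto)
  moreover have "(\<integral>z. f z \<partial>distr (K x) (N \<Otimes>\<^sub>M E) (Pair x)) = (\<integral>y. f (x, y) \<partial>K x)" if "x \<in> space N" for x
  proof -
    have "sets (K x) = sets E" using measurable_space[OF K that] by (simp add: space_prob_algebra)
    with that f show ?thesis
      by (intro integral_distr) (auto cong: measurable_cong_sets)
  qed
  ultimately show ?thesis
    by (simp cong: measurable_cong)
qed

lemma Bb_integral_kernel:
  fixes f :: "'x::second_countable_topology \<times> 'y::second_countable_topology \<Rightarrow> real"
  assumes K: "K \<in> borel \<rightarrow>\<^sub>M prob_algebra borel" and f: "f \<in> Bb"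
  shows "(\<lambda>x. \<integral>y. f (x, y) \<partial>K x) \<in> Bb"
proof -
  obtain B where B: "\<And>x. \<bar>f x\<bar> \<le> B" using f by (rule Bb_boundE) blast
  have "(\<lambda>x. \<integral>y. f (x, y) \<partial>K x) \<in> borel_measurable borel"
    using f by (intro borel_measurable_integral_kernel[OF K]) (simp add: Bb_iff borel_prod)
  moreover have "\<bar>\<integral>y. f (x, y) \<partial>K x\<bar> \<le> B" for x
    by (rule Prob_integral_bound) (use B Prob_kernel[OF K] in auto)
  ultimately show ?thesis by (auto simp: Bb_iff)
qed

lemma Bb_integral_kernel':
  assumes K: "K \<in> borel \<rightarrow>\<^sub>M prob_algebra borel" and f: "f \<in> Bb"
  shows "(\<lambda>x. \<integral>y. f y \<partial>K x) \<in> Bb"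
proof -
  obtain B where B: "\<And>x. \<bar>f x\<bar> \<le> B" using f by (rule Bb_boundE) blast
  have "(\<lambda>x. \<integral>y. f y \<partial>K x) \<in> borel_measurable borel"
    using f by (intro measurable_compose[OF measurable_prob_algebraD[OF K] integral_measurable_subprob_algebra])
      (simp add: Bb_iff)
  moreover have "\<bar>\<integral>y. f y \<partial>K x\<bar> \<le> B" for x
    by (rule Prob_integral_bound) (use B Prob_kernel[OF K] in auto)
  ultimately show ?thesis by (auto simp: Bb_iff)
qed

text \<open>Integrability makes the positive and negative parts finite, so \<open>eintegral\<close>
  subtracts two reals.\<close>

lemma eintegral_ereal:
  assumes "integrable M f"
  shows "eintegral M (\<lambda>x. ereal (f x)) = ereal (\<integral>x. f x \<partial>M)"
proof -
  have fin: "(\<integral>\<^sup>+x. ennreal (f x) \<partial>M) \<noteq> \<infinity>" "(\<integral>\<^sup>+x. ennreal (- f x) \<partial>M) \<noteq> \<infinity>"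
    using assms by (auto simp: real_integrable_def)
  then obtain a b where "0 \<le> a" "0 \<le> b" "(\<integral>\<^sup>+x. ennreal (f x) \<partial>M) = ennreal a"
      "(\<integral>\<^sup>+x. ennreal (- f x) \<partial>M) = ennreal b"
    by (metis ennreal_cases infinity_ennreal_def)
  then show ?thesis
    by (simp add: eintegral_def real_lebesgue_integral_def[OF assms] e2ennreal_ereal enn2ereal_ennreal)
qed

text \<open>Monotonicity of \<open>nn_integral\<close> and of subtraction in \<open>ereal\<close>
  holds for arbitrary functions. Integrands containing the relative entropy of a history-dependent
  policy can thus be compared without a measurability proof.\<close>

lemma eintegral_mono_AE: "AE x in M. f x \<le> g x \<Longrightarrow> eintegral M f \<le> eintegral M g"
  unfolding eintegral_def
  by (intro ereal_minus_mono; subst less_eq_ennreal.rep_eq[symmetric]; intro nn_integral_mono_AE)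
     (auto elim!: eventually_mono intro: e2ennreal_mono)

lemma eintegral_cong_AE: "AE x in M. f x = g x \<Longrightarrow> eintegral M f = eintegral M g"
  by (intro antisym eintegral_mono_AE) (auto elim: eventually_mono)

lemma Prob_eintegral:
  "m \<in> Prob \<Longrightarrow> f \<in> Bb \<Longrightarrow> eintegral m (\<lambda>x. ereal (f x)) = ereal (\<integral>x. f x \<partial>m)"
  by (intro eintegral_ereal Prob_integrable)

section \<open>Measures with bounded log-density and their relative entropies\<close>

definition exp_density :: "'a measure \<Rightarrow> ('a \<Rightarrow> real) \<Rightarrow> 'a measure" where
  "exp_density \<mu> l = density \<mu> (\<lambda>a. ennreal (exp (l a)))"

lemma sets_exp_density[simp]: "sets (exp_density \<mu> l) = sets \<mu>"
  by (simp add: exp_density_def)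

lemma exp_density_Prob:
  assumes \<mu>: "\<mu> \<in> Prob" and l: "l \<in> Bb" and 1: "(\<integral>a. exp (l a) \<partial>\<mu>) = 1"
  shows "exp_density \<mu> l \<in> Prob"
proof (rule ProbI)
  have m[measurable]: "l \<in> borel_measurable \<mu>"
    using Bb_measurable[OF l] ProbD(1)[OF \<mu>] by (simp cong: measurable_cong_sets)
  have "(\<integral>\<^sup>+a. ennreal (exp (l a)) \<partial>\<mu>) = ennreal (\<integral>a. exp (l a) \<partial>\<mu>)"
    by (intro nn_integral_eq_integral Prob_integrable[OF \<mu>] Bb_exp l) auto
  then show "prob_space (exp_density \<mu> l)"
    unfolding exp_density_def using 1 by (intro prob_spaceI) (simp add: emeasure_density)
qed (simp add: ProbD[OF \<mu>])

lemma integral_exp_density: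
  assumes \<mu>: "\<mu> \<in> Prob" and l: "l \<in> Bb" and g: "g \<in> Bb"
  shows "(\<integral>a. g a \<partial>exp_density \<mu> l) = (\<integral>a. exp (l a) * g a \<partial>\<mu>)"
proof -
  have [measurable]: "l \<in> borel_measurable \<mu>" "g \<in> borel_measurable \<mu>"
    using Bb_measurable[OF l] Bb_measurable[OF g] ProbD(1)[OF \<mu>] by (simp_all cong: measurable_cong_sets)
  show ?thesis unfolding exp_density_def by (subst integral_density) auto
qed

text \<open>The density is strictly positive, so both measures have the same null sets.\<close>

lemma AE_exp_density_iff:
  assumes \<mu>: "\<mu> \<in> Prob" and l: "l \<in> Bb"
  shows "(AE a in exp_density \<mu> l. Q a) \<longleftrightarrow> (AE a in \<mu>. Q a)"
proof -
  have [measurable]: "l \<in> borel_measurable \<mu>"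
    using Bb_measurable[OF l] ProbD(1)[OF \<mu>] by (simp cong: measurable_cong_sets)
  show ?thesis unfolding exp_density_def by (subst AE_density) auto
qed

text \<open>Log-densities add under a change of reference measure; this is the reason for writing
  densities as exponentials.\<close>

lemma exp_density_exp_density:
  assumes \<mu>: "\<mu> \<in> Prob" and a: "a \<in> Bb" and b: "b \<in> Bb"
  shows "exp_density (exp_density \<mu> a) b = exp_density \<mu> (\<lambda>x. a x + b x)"
proof -
  have [measurable]: "a \<in> borel_measurable \<mu>" "b \<in> borel_measurable \<mu>"
    using Bb_measurable[OF a] Bb_measurable[OF b] ProbD(1)[OF \<mu>] by (simp_all cong: measurable_cong_sets)
  show ?thesis unfolding exp_density_def
    by (subst density_density_eq) (auto simp: ennreal_mult' exp_add)
qed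

lemma exp_density_0: "exp_density \<mu> (\<lambda>_. 0) = \<mu>"
  by (simp add: exp_density_def density_1)

lemma absolutely_continuous_exp_density:
  assumes "\<mu> \<in> Prob" "l \<in> Bb"
  shows "absolutely_continuous \<mu> (exp_density \<mu> l)"
proof -
  have [measurable]: "l \<in> borel_measurable \<mu>"
    using Bb_measurable[OF assms(2)] ProbD(1)[OF assms(1)] by (simp cong: measurable_cong_sets)
  show ?thesis unfolding exp_density_def by (intro absolutely_continuousI_density) auto
qed

lemma RN_deriv_exp_density:
  assumes \<mu>: "\<mu> \<in> Prob" and l: "l \<in> Bb"
  shows "AE a in \<mu>. ln (enn2real (RN_deriv \<mu> (exp_density \<mu> l) a)) = l a"
proof -
  interpret prob_space \<mu> using \<mu> by (rule ProbD)
  have [measurable]: "l \<in> borel_measurable \<mu>"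
    using Bb_measurable[OF l] ProbD(1)[OF \<mu>] by (simp cong: measurable_cong_sets)
  have "AE a in \<mu>. ennreal (exp (l a)) = RN_deriv \<mu> (exp_density \<mu> l) a"
    by (rule RN_deriv_unique) (auto simp: exp_density_def)
  then show ?thesis by eventually_elim (metis enn2real_ennreal exp_ge_zero ln_exp)
qed

text \<open>Relative to \<open>exp_density \<mu> b\<close> the first measure has log-density
  \<open>a - b\<close>, which by uniqueness is almost everywhere the logarithm of the Radon-Nikodym
  derivative.\<close>

lemma KL_exp_density:
  assumes \<mu>: "\<mu> \<in> Prob" and a: "a \<in> Bb" "(\<integral>x. exp (a x) \<partial>\<mu>) = 1"
    and b: "b \<in> Bb" "(\<integral>x. exp (b x) \<partial>\<mu>) = 1"
  shows "KL (exp_density \<mu> a) (exp_density \<mu> b) = ereal (\<integral>x. a x - b x \<partial>exp_density \<mu> a)"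
proof -
  let ?A = "exp_density \<mu> a" and ?B = "exp_density \<mu> b"
  have AB: "?A \<in> Prob" "?B \<in> Prob" using assms by (auto intro: exp_density_Prob)
  have ab: "(\<lambda>x. a x - b x) \<in> Bb" by (intro Bb_intros a b)
  have eq: "?A = exp_density ?B (\<lambda>x. a x - b x)"
    by (simp add: exp_density_exp_density[OF \<mu> b(1) ab])
  have ac: "absolutely_continuous ?B ?A"
    unfolding eq by (rule absolutely_continuous_exp_density[OF AB(2) ab])
  have "AE x in ?B. ln (enn2real (RN_deriv ?B ?A x)) = a x - b x"
    unfolding eq by (rule RN_deriv_exp_density[OF AB(2) ab])
  then have "AE x in ?A. ereal (ln (enn2real (RN_deriv ?B ?A x))) = ereal (a x - b x)"
    using AE_exp_density_iff[OF \<mu> a(1)] AE_exp_density_iff[OF \<mu> b(1)] by simp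
  from eintegral_cong_AE[OF this] show ?thesis
    unfolding KL_def using ac by (simp add: Prob_eintegral[OF AB(1) ab])
qed

lemma KL_exp_density_base:
  assumes \<mu>: "\<mu> \<in> Prob" and a: "a \<in> Bb" "(\<integral>x. exp (a x) \<partial>\<mu>) = 1"
  shows "KL (exp_density \<mu> a) \<mu> = ereal (\<integral>x. a x \<partial>exp_density \<mu> a)"
  using KL_exp_density[OF \<mu> a, of "\<lambda>_. 0"] ProbD(2)[OF \<mu>]
  by (simp add: exp_density_0 Bb_const prob_space.prob_space)

text \<open>The inequality \<open>ln r \<ge> l + 1 - e\<^sup>l / r\<close> for the density \<open>r\<close> of \<open>m\<close>, integrated against \<open>m\<close>.\<close>

lemma KL_ge_integral:
  assumes \<mu>: "\<mu> \<in> Prob" and m: "m \<in> Prob" and l: "l \<in> Bb" "(\<integral>x. exp (l x) \<partial>\<mu>) = 1"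
  shows "ereal (\<integral>x. l x \<partial>m) \<le> KL m \<mu>"
proof (cases "absolutely_continuous \<mu> m")
  case True
  interpret \<mu>: prob_space \<mu> using \<mu> by (rule ProbD)
  interpret m: prob_space m using m by (rule ProbD)
  have [measurable_cong]: "sets \<mu> = sets borel" "sets m = sets borel" using \<mu> m by (auto dest: ProbD)
  note [measurable] = Bb_measurable[OF l(1)]
  define r where "r = RN_deriv \<mu> m"
  have [measurable]: "r \<in> borel_measurable borel"
    unfolding r_def using borel_measurable_RN_deriv[of \<mu> m] by (simp cong: measurable_cong_sets)
  have sets: "sets m = sets \<mu>" using \<mu> m by (simp add: ProbD)
  have dens: "density \<mu> r = m" unfolding r_def by (rule \<mu>.density_RN_deriv[OF True sets])
  have fin: "AE x in \<mu>. r x \<noteq> \<infinity>" unfolding r_def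
    by (rule \<mu>.RN_deriv_finite[OF _ True sets]) (rule m.sigma_finite_measure)
  \<comment> \<open>The measure \<open>m\<close> has density \<open>r\<close>, so it gives no mass
    to the set where \<open>r\<close> vanishes.\<close>
  have pos: "AE x in m. 0 < r x \<and> r x \<noteq> \<infinity>"
    unfolding dens[symmetric] by (subst AE_density) (use fin in \<open>auto elim: eventually_mono\<close>)
  let ?g = "\<lambda>x. exp (l x) / enn2real (r x)"
  \<comment> \<open>In general only an inequality holds: the mass of \<open>exp l\<close> lying
    where \<open>r\<close> vanishes is lost on the left.\<close>
  have le1: "(\<integral>\<^sup>+x. ennreal (?g x) \<partial>m) \<le> 1"
  proof -
    have "(\<integral>\<^sup>+x. ennreal (?g x) \<partial>m) = (\<integral>\<^sup>+x. r x * ennreal (?g x) \<partial>\<mu>)"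
      unfolding dens[symmetric] by (rule nn_integral_density) auto
    also have "\<dots> \<le> (\<integral>\<^sup>+x. ennreal (exp (l x)) \<partial>\<mu>)"
    proof (rule nn_integral_mono_AE, use fin in eventually_elim)
      fix x assume "r x \<noteq> \<infinity>"
      then obtain q where q: "0 \<le> q" "r x = ennreal q" by (metis ennreal_cases infinity_ennreal_def)
      then show "r x * ennreal (?g x) \<le> ennreal (exp (l x))"
        by (cases "q = 0") (auto simp: ennreal_mult'[symmetric])
    qed
    also have "\<dots> = ennreal (\<integral>x. exp (l x) \<partial>\<mu>)"
      by (intro nn_integral_eq_integral Prob_integrable[OF \<mu>] Bb_exp l) auto
    finally show ?thesis using l by simp
  qed
  have int: "integrable m ?g"
    by (rule integrableI_bounded) (use le1 in \<open>auto simp: order.strict_trans1[of _ 1]\<close>)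
  have "ennreal (\<integral>x. ?g x \<partial>m) \<le> 1"
    using le1 nn_integral_eq_integral[OF int] by simp
  then have I: "(\<integral>x. ?g x \<partial>m) \<le> 1" by simp
  have "ereal (\<integral>x. l x \<partial>m) \<le> ereal (\<integral>x. l x + 1 - ?g x \<partial>m)"
    using I int Prob_integrable[OF m l(1)] by (simp add: m.prob_space)
  also have "\<dots> = eintegral m (\<lambda>x. ereal (l x + 1 - ?g x))"
    using int Prob_integrable[OF m l(1)] by (intro eintegral_ereal[symmetric]) auto
  also have "\<dots> \<le> eintegral m (\<lambda>x. ereal (ln (enn2real (r x))))"
  proof (rule eintegral_mono_AE, use pos in eventually_elim)
    fix x assume "0 < r x \<and> r x \<noteq> \<infinity>"
    then have q: "0 < enn2real (r x)" by (simp add: enn2real_positive_iff less_top)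
    have "ln (?g x) \<le> ?g x - 1" using q by (intro ln_le_minus_one) auto
    then show "ereal (l x + 1 - ?g x) \<le> ereal (ln (enn2real (r x)))"
      using q by (simp add: ln_div)
  qed
  finally show ?thesis using True by (simp add: KL_def r_def)
qed (simp add: KL_def)

text \<open>Iterates of a contraction converge uniformly, so their limit stays bounded and measurable.\<close>

lemma Bb_contraction_fixpoint:
  fixes T :: "('e::topological_space \<Rightarrow> real) \<Rightarrow> 'e \<Rightarrow> real"
  assumes \<gamma>: "0 \<le> \<gamma>" "\<gamma> < 1"
    and T: "\<And>u. u \<in> Bb \<Longrightarrow> T u \<in> Bb"
    and contr: "\<And>u v K x. u \<in> Bb \<Longrightarrow> v \<in> Bb \<Longrightarrow> (\<And>x. \<bar>u x - v x\<bar> \<le> K) \<Longrightarrow> \<bar>T u x - T v x\<bar> \<le> \<gamma> * K"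
  obtains u where "u \<in> Bb" "T u = u"
proof -
  define u where "u n = (T ^^ n) (\<lambda>_. 0)" for n
  have u: "u n \<in> Bb" for n unfolding u_def by (induction n) (auto intro: T Bb_const)
  have uS: "u (Suc n) = T (u n)" for n by (simp add: u_def)
  obtain K where K: "0 \<le> K" "\<And>x. \<bar>u 1 x\<bar> \<le> K" using u[of 1] by (rule Bb_boundE) blast
  have step: "\<bar>u (Suc n) x - u n x\<bar> \<le> K * \<gamma> ^ n" for n x
  proof (induction n arbitrary: x)
    case 0 then show ?case using K by (simp add: u_def)
  next
    case (Suc n)
    have "\<bar>T (u (Suc n)) x - T (u n) x\<bar> \<le> \<gamma> * (K * \<gamma> ^ n)"
      by (rule contr[OF u u]) (rule Suc)
    then show ?case by (simp add: uS mult_ac)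
  qed
  have summ: "summable (\<lambda>n. u (Suc n) x - u n x)" for x
    by (rule summable_comparison_test[of _ "\<lambda>n. K * \<gamma> ^ n"])
       (use step \<gamma> in \<open>auto intro!: exI[of _ 0] summable_mult summable_geometric\<close>)
  \<comment> \<open>The limit is written as a telescoping series dominated by a geometric one. The
    iteration starts at 0, so no initial term is left over.\<close>
  define w where "w x = (\<Sum>n. u (Suc n) x - u n x)" for x
  have lim: "(\<lambda>n. u n x) \<longlonglongrightarrow> w x" for x
  proof -
    have "(\<lambda>n. \<Sum>i<n. u (Suc i) x - u i x) \<longlonglongrightarrow> w x"
      unfolding w_def by (rule summable_LIMSEQ[OF summ])
    then show ?thesis unfolding sum_lessThan_telescope[of "\<lambda>n. u n x"] by (simp add: u_def)
  qed
  \<comment> \<open>The error bound is uniform in \<open>x\<close>. At \<open>n = 0\<close> it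
    bounds \<open>w\<close>; for general \<open>n\<close> it enters the contraction estimate that
    yields \<open>T w = w\<close>.\<close>
  have dist: "\<bar>w x - u n x\<bar> \<le> K * \<gamma> ^ n / (1 - \<gamma>)" for x n
  proof -
    have bd: "\<bar>u (n + k) x - u n x\<bar> \<le> K * \<gamma> ^ n / (1 - \<gamma>)" for k
    proof -
      have "u (n + k) x - u n x = (\<Sum>i<k. u (Suc (n + i)) x - u (n + i) x)"
        by (induction k) auto
      also have "\<bar>\<dots>\<bar> \<le> (\<Sum>i<k. K * \<gamma> ^ (n + i))"
        by (intro order.trans[OF sum_abs] sum_mono step)
      also have "\<dots> = K * \<gamma> ^ n * (\<Sum>i<k. \<gamma> ^ i)"
        by (simp add: sum_distrib_left power_add mult_ac)
      also have "\<dots> \<le> K * \<gamma> ^ n * (1 / (1 - \<gamma>))"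
        using \<gamma> K by (intro mult_left_mono) (auto simp: sum_gp_strict divide_simps)
      finally show ?thesis by simp
    qed
    have "(\<lambda>k. \<bar>u (n + k) x - u n x\<bar>) \<longlonglongrightarrow> \<bar>w x - u n x\<bar>"
      using LIMSEQ_ignore_initial_segment[OF lim, of n x] by (intro tendsto_intros) (simp add: add.commute)
    then show ?thesis by (rule LIMSEQ_le_const2) (use bd in auto)
  qed
  have w: "w \<in> Bb"
  proof (rule BbI)
    show "w \<in> borel_measurable borel"
      by (rule borel_measurable_LIMSEQ_metric[OF Bb_measurable[OF u] lim])
    show "\<bar>w x\<bar> \<le> K * \<gamma> ^ 0 / (1 - \<gamma>)" for x using dist[of x 0] by (simp add: u_def)
  qed
  have "T w x = w x" for x
  proof -
    have bd: "norm (T w x - u (Suc n) x) \<le> \<gamma> * (K * \<gamma> ^ n / (1 - \<gamma>))" for n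
      unfolding uS real_norm_def by (rule contr[OF w u]) (rule dist)
    have "(\<lambda>n. \<gamma> * (K * \<gamma> ^ n / (1 - \<gamma>))) \<longlonglongrightarrow> \<gamma> * (K * 0 / (1 - \<gamma>))"
      by (intro tendsto_mult tendsto_divide tendsto_const LIMSEQ_power_zero) (use \<gamma> in auto)
    then have "(\<lambda>n. \<gamma> * (K * \<gamma> ^ n / (1 - \<gamma>))) \<longlonglongrightarrow> 0"
      by simp
    with bd have "(\<lambda>n. T w x - u (Suc n) x) \<longlonglongrightarrow> 0"
      by (rule Lim_null_comparison[OF always_eventually[OF allI]])
    moreover have "(\<lambda>n. T w x - u (Suc n) x) \<longlonglongrightarrow> T w x - w x"
      by (intro tendsto_intros LIMSEQ_Suc lim)
    ultimately show ?thesis using LIMSEQ_unique by fastforce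
  qed
  with w that show thesis by blast
qed

subsection \<open>Trajectory laws\<close>

lemma integral_bind_prob:
  fixes f :: "_ \<Rightarrow> real"
  assumes M: "prob_space M" "sets M = sets N" and K: "K \<in> N \<rightarrow>\<^sub>M prob_algebra L"
    and f: "f \<in> borel_measurable L" "\<And>x. \<bar>f x\<bar> \<le> B"
  shows "(\<integral>x. f x \<partial>(M \<bind> K)) = (\<integral>x. \<integral>y. f y \<partial>K x \<partial>M)"
proof (rule integral_bind[where B=B and B'=1 and K=L])
  have K': "K \<in> M \<rightarrow>\<^sub>M prob_algebra L" using K M(2) by (simp cong: measurable_cong_sets)
  then show "K \<in> M \<rightarrow>\<^sub>M subprob_algebra L" by (rule measurable_prob_algebraD)
  have "prob_space (K x)" if "x \<in> space M" for x
    using measurable_space[OF K' that] by (simp add: space_prob_algebra)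
  then show "AE x in M. emeasure (K x) (space (K x)) \<le> ennreal 1"
    by (auto simp: prob_space.emeasure_space_1)
qed (use f M in \<open>auto intro: prob_space.finite_measure\<close>)

lemma Prob_integral_bind:
  fixes f :: "_ \<Rightarrow> real"
  assumes "m \<in> Prob" "K \<in> borel \<rightarrow>\<^sub>M prob_algebra borel" "f \<in> Bb"
  shows "(\<integral>x. f x \<partial>(m \<bind> K)) = (\<integral>x. \<integral>y. f y \<partial>K x \<partial>m)"
  using assms(3) by (auto simp: Bb_iff intro!: integral_bind_prob[OF ProbD(2,1)] assms)

lemma Prob_bind:
  "m \<in> Prob \<Longrightarrow> K \<in> borel \<rightarrow>\<^sub>M prob_algebra borel \<Longrightarrow> m \<bind> K \<in> Prob"
  unfolding Prob_def using prob_space_bind'[of m borel K borel] sets_bind'[of m borel K borel]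
  by (simp add: space_prob_algebra)

lemma policies_kernel:
  assumes "\<pi> \<in> policies" "\<eta> \<in> space (PiM {0..<n} (\<lambda>_. borel))"
  shows "(\<lambda>s. \<pi> n (\<eta>, s)) \<in> borel \<rightarrow>\<^sub>M prob_algebra borel"
  using assms unfolding policies_def hist_space_def
  by (intro measurable_compose[OF measurable_Pair1'[of \<eta>]]) auto

lemma state_action_kernel:
  fixes K :: "'s::polish_space \<Rightarrow> 'a::polish_space measure"
  assumes K: "K \<in> borel \<rightarrow>\<^sub>M prob_algebra borel"
  shows "(\<lambda>s. K s \<bind> (\<lambda>a. return borel (s, a))) \<in> borel \<rightarrow>\<^sub>M prob_algebra borel"
proof -
  have "(\<lambda>x :: 's \<times> 'a. return borel x) \<in> borel \<Otimes>\<^sub>M borel \<rightarrow>\<^sub>M prob_algebra borel"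
    unfolding borel_prod by measurable
  then show ?thesis
    using measurable_bind_prob_space2[OF K, of "\<lambda>s a. return borel (s, a)"] by (simp add: case_prod_beta')
qed

lemma integral_state_action:
  fixes K :: "'s::polish_space \<Rightarrow> 'a::polish_space measure" and G :: "'s \<times> 'a \<Rightarrow> real"
  assumes m: "m \<in> Prob" and K: "K \<in> borel \<rightarrow>\<^sub>M prob_algebra borel" and G: "G \<in> Bb"
  shows "(\<integral>x. G x \<partial>(m \<bind> (\<lambda>s. K s \<bind> (\<lambda>a. return borel (s, a))))) = (\<integral>s. \<integral>a. G (s, a) \<partial>K s \<partial>m)"
proof -
  have "(\<integral>x. G x \<partial>(K s \<bind> (\<lambda>a. return borel (s, a)))) = (\<integral>a. G (s, a) \<partial>K s)" for s
  proof -
    have "(\<lambda>a :: 'a. return borel (s, a)) \<in> borel \<rightarrow>\<^sub>M prob_algebra borel"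
    proof -
      have "(Pair s :: 'a \<Rightarrow> _) \<in> borel \<rightarrow>\<^sub>M borel \<Otimes>\<^sub>M borel" by measurable
      then have "(Pair s :: 'a \<Rightarrow> _) \<in> borel \<rightarrow>\<^sub>M borel" unfolding borel_prod .
      then show ?thesis by (rule measurable_compose[OF _ measurable_return_prob_space])
    qed
    then show ?thesis
      using G Prob_kernel[OF K, of s]
      by (subst Prob_integral_bind) (auto simp: integral_return Bb_measurable)
  qed
  then show ?thesis
    using m G by (subst Prob_integral_bind) (auto intro: state_action_kernel[OF K])
qed

locale trajectory =
  fixes P :: "'s::polish_space \<times> 'a::polish_space \<Rightarrow> 's measure"
    and \<pi> :: "nat \<Rightarrow> (nat \<Rightarrow> 's \<times> 'a) \<times> 's \<Rightarrow> 'a measure" and s :: 's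
  assumes P: "P \<in> borel \<rightarrow>\<^sub>M prob_algebra borel" and \<pi>: "\<pi> \<in> policies"
begin

sublocale IT: Ionescu_Tulcea "step_kernel P \<pi> s" "\<lambda>_. borel"
  by (rule Ionescu_Tulcea_step_kernel[OF P \<pi>])

abbreviation "T \<equiv> traj P \<pi> s"
abbreviation past :: "nat \<Rightarrow> (nat \<Rightarrow> 's \<times> 'a) \<Rightarrow> nat \<Rightarrow> 's \<times> 'a" where
  "past n \<omega> \<equiv> restrict \<omega> {0..<n}"
abbreviation hist :: "nat \<Rightarrow> (nat \<Rightarrow> 's \<times> 'a) measure" where
  "hist n \<equiv> PiM {0..<n} (\<lambda>_. borel)"

lemma T_def: "T = IT.PF.lim"
  by (simp add: traj_def)

lemma sets_T[simp, measurable_cong]: "sets T = sets (PiM UNIV (\<lambda>_. borel))"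
  by (simp add: T_def)

lemma space_T[simp]: "space T = UNIV"
  by (simp add: T_def space_PiM)

lemma past_measurable[measurable]: "past n \<in> T \<rightarrow>\<^sub>M hist n"
  by measurable

lemma past_space: "past n \<omega> \<in> space (hist n)"
  by (simp add: space_PiM)

text \<open>Links the projective limit to the finite compositions \<open>IT.C\<close>, in which the
  step kernels appear explicitly.\<close>

lemma distr_past: "distr T (hist n) (past n) = IT.C 0 n (\<lambda>_. undefined)"
proof -
  \<comment> \<open>\<open>IT.CI\<close> of a finite index set is defined through the least bound
    above it, here \<open>n\<close> itself.\<close>
  have "IT.up_to {0..<n} = n" unfolding IT.up_to_def by (rule Least_equality) (auto simp: not_le[symmetric])
  then have "IT.CI {0..<n} = IT.C 0 n (\<lambda>_. undefined)"
    unfolding IT.CI_def using IT.distr_C[of n n "\<lambda>_. undefined" 0] by (simp add: space_PiM)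
  then show ?thesis unfolding T_def using IT.distr_lim[of "{0..<n}"] by simp
qed

text \<open>The total mass can be read off from any marginal; the one on the empty past
  suffices.\<close>

lemma prob_space_T: "prob_space T"
proof (rule prob_space_distrD)
  show "prob_space (distr T (hist 0) (past 0))"
    unfolding distr_past by (rule IT.prob_space_C) (simp add: space_PiM)
qed measurable

lemma integral_past:
  "f \<in> borel_measurable (hist n) \<Longrightarrow> (\<integral>\<omega>. f (past n \<omega>) \<partial>T) = (\<integral>\<eta>. f \<eta> \<partial>IT.C 0 n (\<lambda>_. undefined))"
  for f :: "_ \<Rightarrow> real"
  unfolding distr_past[symmetric] by (rule integral_distr[symmetric, OF past_measurable])

lemma integral_step_kernel:
  fixes G :: "'s \<times> 'a \<Rightarrow> real"
  assumes \<eta>: "\<eta> \<in> space (hist n)" and G: "G \<in> Bb"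
  shows "(\<integral>x. G x \<partial>step_kernel P \<pi> s n \<eta>) =
    (\<integral>s'. \<integral>a. G (s', a) \<partial>\<pi> n (\<eta>, s') \<partial>(case n of 0 \<Rightarrow> return borel s | Suc k \<Rightarrow> P (\<eta> k)))"
proof -
  have "(case n of 0 \<Rightarrow> return borel s | Suc k \<Rightarrow> P (\<eta> k)) \<in> Prob"
    using Prob_kernel[OF P] by (auto split: nat.split simp: Prob_def space_prob_algebra prob_space_return)
  then show ?thesis
    unfolding step_kernel_def by (rule integral_state_action[OF _ policies_kernel[OF \<pi> \<eta>] G])
qed

text \<open>Tower property: the law of the first \<open>n + 1\<close> coordinates is the law of the
  first \<open>n\<close> bound with \<open>IT.eP n\<close>, which appends a sample of the step
  kernel. Both sides reduce to these finite marginals.\<close>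

lemma integral_traj_step:
  fixes F :: "(nat \<Rightarrow> 's \<times> 'a) \<times> ('s \<times> 'a) \<Rightarrow> real"
  assumes F[measurable]: "F \<in> borel_measurable (hist n \<Otimes>\<^sub>M borel)" and B: "\<And>z. \<bar>F z\<bar> \<le> B"
  shows "(\<integral>\<omega>. F (past n \<omega>, \<omega> n) \<partial>T) =
    (\<integral>\<omega>. (\<integral>x. F (past n \<omega>, x) \<partial>step_kernel P \<pi> s n (past n \<omega>)) \<partial>T)"
proof -
  let ?F = "\<lambda>\<eta>. F (past n \<eta>, \<eta> n)"
  have K: "IT.eP n \<in> hist n \<rightarrow>\<^sub>M prob_algebra (hist (Suc n))"
    using IT.prob_space_eP IT.measurable_eP by (intro measurable_prob_algebraI) auto
  have [measurable]: "(\<lambda>\<eta>. past n \<eta>) \<in> hist (Suc n) \<rightarrow>\<^sub>M hist n"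
    by (intro measurable_restrict_subset) auto
  have F'[measurable]: "?F \<in> borel_measurable (hist (Suc n))"
    by measurable
  have "(\<integral>\<omega>. F (past n \<omega>, \<omega> n) \<partial>T) = (\<integral>\<omega>. ?F (past (Suc n) \<omega>) \<partial>T)"
    by (intro Bochner_Integration.integral_cong arg_cong[where f=F]) auto
  also have "\<dots> = (\<integral>\<eta>. ?F \<eta> \<partial>IT.C 0 (Suc n) (\<lambda>_. undefined))"
    by (rule integral_past[OF F'])
  also have "\<dots> = (\<integral>\<eta>. \<integral>x. ?F x \<partial>IT.eP n \<eta> \<partial>IT.C 0 n (\<lambda>_. undefined))"
    using B unfolding IT.C.simps add_0
    by (intro integral_bind_prob[OF _ _ K F', of _ B]) (auto simp: IT.prob_space_C IT.sets_C space_PiM)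
  also have "\<dots> = (\<integral>\<eta>. \<integral>x. F (\<eta>, x) \<partial>step_kernel P \<pi> s n \<eta> \<partial>IT.C 0 n (\<lambda>_. undefined))"
  proof (rule Bochner_Integration.integral_cong[OF refl])
    fix \<eta> assume "\<eta> \<in> space (IT.C 0 n (\<lambda>_. undefined))"
    then have \<eta>: "\<eta> \<in> space (hist n)" by (simp add: IT.space_C space_PiM)
    then have [measurable]: "fun_upd \<eta> n \<in> step_kernel P \<pi> s n \<eta> \<rightarrow>\<^sub>M hist (Suc n)"
      using IT.sets_P[OF \<eta>] by (intro measurable_fun_upd[where J="{0..<n}"]) auto
    \<comment> \<open>Points of \<open>hist n\<close> are \<open>undefined\<close> outside
      \<open>{0..<n}\<close>, so restricting after the update at \<open>n\<close> restores
      \<open>\<eta>\<close> exactly.\<close>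
    have [simp]: "past n (\<eta>(n := x)) = \<eta>" for x
      using \<eta> by (auto simp: space_PiM PiE_iff extensional_def restrict_def)
    show "(\<integral>x. ?F x \<partial>IT.eP n \<eta>) = (\<integral>x. F (\<eta>, x) \<partial>step_kernel P \<pi> s n \<eta>)"
      unfolding IT.eP_def by (subst integral_distr) auto
  qed
  also have "\<dots> = (\<integral>\<omega>. (\<integral>x. F (past n \<omega>, x) \<partial>step_kernel P \<pi> s n (past n \<omega>)) \<partial>T)"
  proof (rule integral_past[symmetric])
    have "step_kernel P \<pi> s n \<in> hist n \<rightarrow>\<^sub>M prob_algebra borel"
      using IT.P IT.prob_space_P by (intro measurable_prob_algebraI) auto
    then show "(\<lambda>\<eta>. \<integral>x. F (\<eta>, x) \<partial>step_kernel P \<pi> s n \<eta>) \<in> borel_measurable (hist n)"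
      by (rule borel_measurable_integral_kernel) measurable
  qed
  finally show ?thesis .
qed

end

subsection \<open>Values of policies along trajectories\<close>

text \<open>The differences \<open>d n\<close> are nonnegative, so their series converges in
  \<open>ereal\<close>; adding back the convergent real series sums \<open>x\<close>. The bound
  \<open>le\<close> excludes \<open>-\<infinity>\<close>, so subtracting and re-adding
  \<open>a n\<close> is exact.\<close>

lemma suminf_ereal_ge:
  assumes a: "summable a" and le: "\<And>n. ereal (a n) \<le> x n"
  shows "ereal (suminf a) \<le> suminf x"
proof -
  define d where "d n = x n - ereal (a n)" for n
  have d0: "0 \<le> d n" for n
    using le[of n] unfolding d_def by (cases "x n") auto
  have x: "x n = ereal (a n) + d n" for n
    unfolding d_def by (cases "x n") auto
  have "d sums suminf d" using d0 by (intro summable_sums summable_ereal_pos)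
  moreover have "(\<lambda>n. ereal (\<Sum>i<n. a i)) \<longlonglongrightarrow> ereal (suminf a)"
    using summable_LIMSEQ[OF a] by simp
  ultimately have "(\<lambda>n. ereal (\<Sum>i<n. a i) + (\<Sum>i<n. d i)) \<longlonglongrightarrow> ereal (suminf a) + suminf d"
    unfolding sums_def by (intro tendsto_add_ereal_general) auto
  then have "x sums (ereal (suminf a) + suminf d)"
    unfolding sums_def x by (simp add: sum.distrib sum_ereal)
  then have "suminf x = ereal (suminf a) + suminf d"
    by (rule sums_unique[symmetric])
  moreover have "0 \<le> suminf d" using d0 by (intro suminf_0_le summable_ereal_pos)
  ultimately show ?thesis using add_left_mono[of 0 "suminf d" "ereal (suminf a)"] by simp
qed

text \<open>Real-valued counterpart of \<open>bellman_Q\<close>; they agree for bounded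
  \<open>v\<close> by \<open>bellman_Q_real\<close>.\<close>

definition Q_real :: "('s \<times> 'a \<Rightarrow> 's measure) \<Rightarrow> ('s \<times> 'a \<Rightarrow> real) \<Rightarrow> real \<Rightarrow> ('s \<Rightarrow> real) \<Rightarrow> 's \<times> 'a \<Rightarrow> real" where
  "Q_real P c \<gamma> v x = c x + \<gamma> * (\<integral>s'. v s' \<partial>P x)"

lemma Q_real_Bb:
  fixes P :: "'s::polish_space \<times> 'a::polish_space \<Rightarrow> 's measure"
  assumes "P \<in> borel \<rightarrow>\<^sub>M prob_algebra borel" "c \<in> Bb" "v \<in> Bb"
  shows "Q_real P c \<gamma> v \<in> Bb"
  unfolding Q_real_def by (intro Bb_add Bb_cmult Bb_integral_kernel' assms)

context trajectory
begin

lemma integrable_T: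
  assumes "f \<in> borel_measurable T" "\<And>\<omega>. \<bar>f \<omega>\<bar> \<le> B"
  shows "integrable T (f :: _ \<Rightarrow> real)"
proof -
  interpret prob_space T by (rule prob_space_T)
  show ?thesis using assms by (intro integrable_const_bound[of _ B]) auto
qed

lemma coord_measurable:
  assumes "f \<in> Bb"
  shows "(\<lambda>\<omega>. f (\<omega> n)) \<in> borel_measurable T"
proof (rule measurable_compose[OF _ Bb_measurable[OF assms]])
  show "(\<lambda>\<omega>. \<omega> n) \<in> T \<rightarrow>\<^sub>M borel" by measurable
qed

lemma integrable_coord:
  assumes "f \<in> Bb"
  shows "integrable T (\<lambda>\<omega>. f (\<omega> n))"
proof -
  obtain B where "\<And>x. \<bar>f x\<bar> \<le> B" using assms by (rule Bb_boundE) blast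
  then show ?thesis by (rule integrable_T[OF coord_measurable[OF assms]])
qed

lemma policy_Prob: "\<pi> n (past n \<omega>, s') \<in> Prob"
  by (rule Prob_kernel[OF policies_kernel[OF \<pi> past_space]]) simp

lemma policy_mass: "measure (\<pi> n (past n \<omega>, s')) (space (\<pi> n (past n \<omega>, s'))) = 1"
  by (rule prob_space.prob_space[OF ProbD(2)[OF policy_Prob]])

lemma expectation_initial: "U \<in> Bb \<Longrightarrow> (\<integral>\<omega>. U (fst (\<omega> 0)) \<partial>T) = U s"
proof -
  assume U: "U \<in> Bb"
  obtain B where B: "\<And>x. \<bar>U x\<bar> \<le> B" using U by (rule Bb_boundE) blast
  note [measurable] = Bb_measurable[OF U]
  have "(\<lambda>z. U (fst (snd z))) \<in> borel_measurable (hist 0 \<Otimes>\<^sub>M (borel :: ('s \<times> 'a) measure))"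
    unfolding borel_prod[symmetric] by measurable
  note integral_traj_step[OF this, of B]
  then have "(\<integral>\<omega>. U (fst (\<omega> 0)) \<partial>T) =
      (\<integral>\<omega>. (\<integral>x. U (fst x) \<partial>step_kernel P \<pi> s 0 (past 0 \<omega>)) \<partial>T)"
    using B by simp
  moreover have "(\<integral>x. U (fst x) \<partial>step_kernel P \<pi> s 0 (past 0 \<omega>)) = U s" for \<omega>
  proof -
    show ?thesis
      using integral_step_kernel[OF past_space Bb_fst[OF U], of 0]
      by (simp add: integral_return policy_mass[of 0, simplified])
  qed
  ultimately show ?thesis by (simp only:) (simp add: prob_space.prob_space[OF prob_space_T, simplified])
qed

lemma expectation_next_state:
  assumes U: "U \<in> Bb"
  shows "(\<integral>\<omega>. U (fst (\<omega> (Suc n))) \<partial>T) = (\<integral>\<omega>. (\<integral>s'. U s' \<partial>P (\<omega> n)) \<partial>T)"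
proof -
  obtain B where B: "\<And>x. \<bar>U x\<bar> \<le> B" using U by (rule Bb_boundE) blast
  note [measurable] = Bb_measurable[OF U]
  have "(\<lambda>z. U (fst (snd z))) \<in> borel_measurable (hist (Suc n) \<Otimes>\<^sub>M (borel :: ('s \<times> 'a) measure))"
    unfolding borel_prod[symmetric] by measurable
  note integral_traj_step[OF this, of B]
  then have "(\<integral>\<omega>. U (fst (\<omega> (Suc n))) \<partial>T) =
      (\<integral>\<omega>. (\<integral>x. U (fst x) \<partial>step_kernel P \<pi> s (Suc n) (past (Suc n) \<omega>)) \<partial>T)"
    using B by simp
  moreover have "(\<integral>x. U (fst x) \<partial>step_kernel P \<pi> s (Suc n) (past (Suc n) \<omega>)) = (\<integral>s'. U s' \<partial>P (\<omega> n))" for \<omega>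
  proof -
    show ?thesis
      using integral_step_kernel[OF past_space Bb_fst[OF U], of "Suc n"] by (simp add: policy_mass)
  qed
  ultimately show ?thesis by (simp only:)
qed

lemma action_average_measurable:
  assumes G: "G \<in> Bb"
  shows "(\<lambda>z. \<integral>a. G (snd z, a) \<partial>\<pi> n z) \<in> borel_measurable (hist n \<Otimes>\<^sub>M borel)"
proof -
  have K: "\<pi> n \<in> hist n \<Otimes>\<^sub>M borel \<rightarrow>\<^sub>M prob_algebra borel"
    using \<pi> by (simp add: policies_def hist_space_def)
  have [measurable]: "G \<in> borel_measurable (borel \<Otimes>\<^sub>M borel)"
    using G by (simp add: Bb_iff borel_prod)
  have "(\<lambda>(z, a). G (snd z, a)) \<in> borel_measurable ((hist n \<Otimes>\<^sub>M borel) \<Otimes>\<^sub>M borel)"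
    by measurable
  from borel_measurable_integral_kernel[OF K this] show ?thesis by simp
qed

text \<open>\<open>G\<close> and its action average have the same integral against the step kernel
  at each past. The tower property is applied once to \<open>G\<close> and once, backwards, to the
  average.\<close>

lemma expectation_action:
  assumes G: "G \<in> Bb"
  shows "(\<integral>\<omega>. G (\<omega> n) \<partial>T) = (\<integral>\<omega>. (\<integral>a. G (fst (\<omega> n), a) \<partial>\<pi> n (past n \<omega>, fst (\<omega> n))) \<partial>T)"
proof -
  obtain B where B: "\<And>x. \<bar>G x\<bar> \<le> B" using G by (rule Bb_boundE) blast
  note [measurable] = Bb_measurable[OF G] action_average_measurable[OF G]
  let ?H = "\<lambda>z. \<integral>a. G (snd z, a) \<partial>\<pi> n z"
  have H_Bb: "(\<lambda>s'. ?H (\<eta>, s')) \<in> Bb" if "\<eta> \<in> space (hist n)" for \<eta>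
    using Bb_integral_kernel[OF policies_kernel[OF \<pi> that] G] by simp
  \<comment> \<open>The inner \<open>past n \<eta>\<close> makes the policy argument a proper
    history for every \<open>\<eta>\<close>, so that \<open>?F\<close> is bounded everywhere, as
    \<open>integral_traj_step\<close> demands.\<close>
  let ?F = "\<lambda>(\<eta>, x :: 's \<times> 'a). \<integral>a. G (fst x, a) \<partial>\<pi> n (past n \<eta>, fst x)"
  have F_meas: "?F \<in> borel_measurable (hist n \<Otimes>\<^sub>M (borel :: ('s \<times> 'a) measure))"
  proof -
    have "(\<lambda>z. (past n (fst z), fst (snd z))) \<in> hist n \<Otimes>\<^sub>M (borel \<Otimes>\<^sub>M borel) \<rightarrow>\<^sub>M hist n \<Otimes>\<^sub>M borel"
      by measurable
    from measurable_compose[OF this action_average_measurable[OF G, of n]]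
    have "?F \<in> borel_measurable (hist n \<Otimes>\<^sub>M (borel \<Otimes>\<^sub>M borel))" by (simp add: case_prod_beta')
    then show ?thesis by (simp only: borel_prod)
  qed
  have F_bound: "\<bar>?F z\<bar> \<le> B" for z
    using B by (auto simp: case_prod_beta' intro!: Prob_integral_bound policy_Prob)
  have "(\<lambda>z. G (snd z)) \<in> borel_measurable (hist n \<Otimes>\<^sub>M borel)" by measurable
  from integral_traj_step[OF this, of B] B
  have "(\<integral>\<omega>. G (\<omega> n) \<partial>T) = (\<integral>\<omega>. (\<integral>x. G x \<partial>step_kernel P \<pi> s n (past n \<omega>)) \<partial>T)"
    by simp
  also have "\<dots> = (\<integral>\<omega>. (\<integral>x. ?F (past n \<omega>, x) \<partial>step_kernel P \<pi> s n (past n \<omega>)) \<partial>T)"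
  proof (rule Bochner_Integration.integral_cong[OF refl])
    fix \<omega>
    show "(\<integral>x. G x \<partial>step_kernel P \<pi> s n (past n \<omega>)) =
        (\<integral>x. ?F (past n \<omega>, x) \<partial>step_kernel P \<pi> s n (past n \<omega>))"
      using integral_step_kernel[OF past_space G, of n \<omega>]
        integral_step_kernel[OF past_space Bb_fst[OF H_Bb[OF past_space]], of n \<omega> \<omega>]
      by (simp add: policy_mass)
  qed
  also have "\<dots> = (\<integral>\<omega>. ?F (past n \<omega>, \<omega> n) \<partial>T)"
    by (rule integral_traj_step[OF F_meas F_bound, symmetric])
  finally show ?thesis by simp
qed

text \<open>If \<open>U\<close> is the value of a stationary policy, \<open>U\<close> minus the
  action average of its Q-function is the entropy cost, so this is the running cost itself. For the
  soft optimal \<open>U\<close> it is a lower bound of the running cost under any policy.\<close>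

definition excess :: "('s \<times> 'a \<Rightarrow> real) \<Rightarrow> real \<Rightarrow> ('s \<Rightarrow> real) \<Rightarrow> nat \<Rightarrow> (nat \<Rightarrow> 's \<times> 'a) \<Rightarrow> real" where
  "excess c \<gamma> U n \<omega> = c (\<omega> n) + U (fst (\<omega> n))
     - (\<integral>a. Q_real P c \<gamma> U (fst (\<omega> n), a) \<partial>\<pi> n (past n \<omega>, fst (\<omega> n)))"

text \<open>Conditioning turns the sum into a telescoping series, whatever the policy.\<close>

lemma expectation_excess:
  assumes c: "c \<in> Bb" and U: "U \<in> Bb" and \<gamma>: "0 \<le> \<gamma>" "\<gamma> < 1"
  shows "summable (\<lambda>n. \<gamma> ^ n * excess c \<gamma> U n \<omega>)"
    and "integrable T (\<lambda>\<omega>. \<Sum>n. \<gamma> ^ n * excess c \<gamma> U n \<omega>)"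
    and "(\<integral>\<omega>. (\<Sum>n. \<gamma> ^ n * excess c \<gamma> U n \<omega>) \<partial>T) = U s"
proof -
  interpret prob_space T by (rule prob_space_T)
  let ?Q = "Q_real P c \<gamma> U"
  let ?y = "excess c \<gamma> U"
  have Q: "?Q \<in> Bb" by (rule Q_real_Bb[OF P c U])
  obtain B1 where B1: "0 \<le> B1" "\<And>x. \<bar>c x\<bar> \<le> B1" using c by (rule Bb_boundE) blast
  obtain B2 where B2: "0 \<le> B2" "\<And>x. \<bar>U x\<bar> \<le> B2" using U by (rule Bb_boundE) blast
  obtain B3 where B3: "0 \<le> B3" "\<And>x. \<bar>?Q x\<bar> \<le> B3" using Q by (rule Bb_boundE) blast
  let ?A = "\<lambda>n \<omega>. \<integral>a. ?Q (fst (\<omega> n), a) \<partial>\<pi> n (past n \<omega>, fst (\<omega> n))"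
  have A_bound: "\<bar>?A n \<omega>\<bar> \<le> B3" for n \<omega>
    using B3 by (auto intro!: Prob_integral_bound policy_Prob)
  have A_meas: "?A n \<in> borel_measurable T" for n
  proof -
    have "fst \<in> (borel :: ('s \<times> 'a) measure) \<rightarrow>\<^sub>M borel"
      unfolding borel_prod[symmetric] by measurable
    then have "(\<lambda>\<omega>. fst (\<omega> n)) \<in> T \<rightarrow>\<^sub>M borel"
      by measurable
    then have "(\<lambda>\<omega>. (past n \<omega>, fst (\<omega> n))) \<in> T \<rightarrow>\<^sub>M hist n \<Otimes>\<^sub>M borel"
      by measurable
    from measurable_compose[OF this action_average_measurable[OF Q]] show ?thesis by simp
  qed
  have A_int: "integrable T (?A n)" for n by (rule integrable_T[OF A_meas A_bound])
  define e where "e n = (\<integral>\<omega>. U (fst (\<omega> n)) \<partial>T)" for n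
  note cint = integrable_coord[OF c] and Uint = integrable_coord[OF Bb_fst[OF U]]
    and PUint = integrable_coord[OF Bb_integral_kernel'[OF P U]]
  have y_bound: "\<bar>?y n \<omega>\<bar> \<le> B1 + B2 + B3" for n \<omega>
    using B1(2)[of "\<omega> n"] B2(2)[of "fst (\<omega> n)"] A_bound[of n \<omega>] unfolding excess_def by linarith
  have y_int: "integrable T (?y n)" for n
    unfolding excess_def by (intro Bochner_Integration.integrable_add Bochner_Integration.integrable_diff cint Uint A_int)
  \<comment> \<open>The action average of \<open>?Q\<close> has the same expectation as
    \<open>?Q\<close> at \<open>\<omega> n\<close>, namely the expected cost plus the discounted
    \<open>e (Suc n)\<close>; the cost cancels.\<close>
  have y_exp: "(\<integral>\<omega>. ?y n \<omega> \<partial>T) = e n - \<gamma> * e (Suc n)" for n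
  proof -
    have "(\<integral>\<omega>. ?y n \<omega> \<partial>T) = (\<integral>\<omega>. c (\<omega> n) \<partial>T) + e n - (\<integral>\<omega>. ?A n \<omega> \<partial>T)"
      unfolding excess_def e_def using cint Uint A_int by simp
    also have "(\<integral>\<omega>. ?A n \<omega> \<partial>T) = (\<integral>\<omega>. ?Q (\<omega> n) \<partial>T)"
      by (rule expectation_action[OF Q, symmetric])
    also have "\<dots> = (\<integral>\<omega>. c (\<omega> n) \<partial>T) + \<gamma> * e (Suc n)"
      unfolding Q_real_def e_def expectation_next_state[OF U] using cint PUint by simp
    finally show ?thesis by simp
  qed
  let ?f = "\<lambda>n \<omega>. \<gamma> ^ n * ?y n \<omega>"
  have f_bound: "norm (?f n \<omega>) \<le> (B1 + B2 + B3) * \<gamma> ^ n" for n \<omega>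
    using y_bound[of n \<omega>] \<gamma> by (simp add: abs_mult mult.commute[of "\<gamma> ^ n"] mult_right_mono)
  have geo: "summable (\<lambda>n. (B1 + B2 + B3) * \<gamma> ^ n)"
    using \<gamma> by (intro summable_mult summable_geometric) auto
  have f_summ: "summable (\<lambda>n. norm (?f n \<omega>))" for \<omega>
    by (rule summable_comparison_test[OF _ geo]) (use f_bound in auto)
  then show "summable (\<lambda>n. ?f n \<omega>)" by (rule summable_norm_cancel)
  have f_int: "integrable T (?f n)" for n using y_int by simp
  have i_summ: "summable (\<lambda>n. \<integral>\<omega>. norm (?f n \<omega>) \<partial>T)"
  proof (rule summable_comparison_test[OF _ geo], intro exI allI impI)
    fix n
    have "(\<integral>\<omega>. norm (?f n \<omega>) \<partial>T) \<le> (\<integral>\<omega>. (B1 + B2 + B3) * \<gamma> ^ n \<partial>T)"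
      by (intro integral_mono integrable_norm f_int f_bound) auto
    then show "norm (\<integral>\<omega>. norm (?f n \<omega>) \<partial>T) \<le> (B1 + B2 + B3) * \<gamma> ^ n"
      by (simp add: prob_space[simplified])
  qed
  show "integrable T (\<lambda>\<omega>. \<Sum>n. ?f n \<omega>)"
    by (rule integrable_suminf[OF f_int _ i_summ]) (use f_summ in auto)
  have "(\<lambda>n. \<integral>\<omega>. ?f n \<omega> \<partial>T) sums (\<integral>\<omega>. (\<Sum>n. ?f n \<omega>) \<partial>T)"
    by (rule sums_integral[OF f_int _ i_summ]) (use f_summ in auto)
  \<comment> \<open>\<open>e\<close> is bounded, so \<open>\<gamma> ^ n * e n\<close> tends to 0 and
    telescoping leaves only \<open>e 0\<close>.\<close>
  moreover have "(\<lambda>n. \<integral>\<omega>. ?f n \<omega> \<partial>T) sums (\<gamma> ^ 0 * e 0 - 0)"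
  proof -
    have e_bound: "\<bar>e n\<bar> \<le> B2" for n
    proof -
      have "\<bar>e n\<bar> \<le> (\<integral>\<omega>. \<bar>U (fst (\<omega> n))\<bar> \<partial>T)" unfolding e_def by (rule integral_abs_bound)
      also have "\<dots> \<le> (\<integral>\<omega>. B2 \<partial>T)" by (intro integral_mono integrable_abs Uint B2) auto
      finally show ?thesis by (simp add: prob_space[simplified])
    qed
    have "(\<lambda>n. \<gamma> ^ n * e n) \<longlonglongrightarrow> 0"
    proof (rule Lim_null_comparison[OF always_eventually[OF allI]])
      show "norm (\<gamma> ^ n * e n) \<le> \<gamma> ^ n * B2" for n
        using e_bound[of n] \<gamma> by (simp add: abs_mult mult_left_mono)
      have "(\<lambda>n. \<gamma> ^ n * B2) \<longlonglongrightarrow> 0 * B2"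
        by (intro tendsto_mult tendsto_const LIMSEQ_power_zero) (use \<gamma> in auto)
      then show "(\<lambda>n. \<gamma> ^ n * B2) \<longlonglongrightarrow> 0" by simp
    qed
    from telescope_sums'[OF this]
    show ?thesis by (simp add: y_exp algebra_simps)
  qed
  ultimately have "(\<integral>\<omega>. (\<Sum>n. ?f n \<omega>) \<partial>T) = e 0" using sums_unique2 by fastforce
  then show "(\<integral>\<omega>. (\<Sum>n. ?f n \<omega>) \<partial>T) = U s" by (simp add: e_def expectation_initial[OF U])
qed

text \<open>The hypothesis bounds the running cost below by \<open>excess\<close> along every path,
  and the discounted series of \<open>excess\<close> integrates to \<open>U s\<close> whatever the
  policy.\<close>

lemma V_ge:
  assumes c: "c \<in> Bb" and U: "U \<in> Bb" and \<gamma>: "0 \<le> \<gamma>" "\<gamma> < 1"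
    and le: "\<And>n z. fst z \<in> space (hist n) \<Longrightarrow>
      ereal (U (snd z) - (\<integral>a. Q_real P c \<gamma> U (snd z, a) \<partial>\<pi> n z)) \<le> ereal \<tau> * KL (\<pi> n z) \<mu>"
  shows "ereal (U s) \<le> V P c \<gamma> \<mu> \<tau> \<pi> s"
proof -
  note E = expectation_excess[OF c U \<gamma>]
  have "ereal (U s) = eintegral T (\<lambda>\<omega>. ereal (\<Sum>n. \<gamma> ^ n * excess c \<gamma> U n \<omega>))"
    by (simp add: eintegral_ereal E)
  also have "\<dots> \<le> V P c \<gamma> \<mu> \<tau> \<pi> s"
    unfolding V_def
  proof (intro eintegral_mono_AE AE_I2 suminf_ereal_ge E)
    fix \<omega> n
    have "ereal (excess c \<gamma> U n \<omega>)
        \<le> ereal (c (\<omega> n)) + ereal \<tau> * KL (\<pi> n (past n \<omega>, fst (\<omega> n))) \<mu>"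
      using add_left_mono[OF le[where n=n and z="(past n \<omega>, fst (\<omega> n))"], of "ereal (c (\<omega> n))"] past_space[of \<omega> n]
      by (simp add: excess_def add_diff_eq)
    then show "ereal (\<gamma> ^ n * excess c \<gamma> U n \<omega>)
        \<le> ereal (\<gamma> ^ n) * (ereal (c (\<omega> n)) + ereal \<tau> * KL (\<pi> n (past n \<omega>, fst (\<omega> n))) \<mu>)"
      unfolding times_ereal.simps(1)[symmetric] using \<gamma> by (intro ereal_mult_left_mono) auto
  qed
  finally show ?thesis .
qed

text \<open>Here the pathwise cost equals an integrable real series, so the extended integral is an
  ordinary one.\<close>

lemma V_eq:
  assumes c: "c \<in> Bb" and U: "U \<in> Bb" and \<gamma>: "0 \<le> \<gamma>" "\<gamma> < 1"
    and eq: "\<And>n z. fst z \<in> space (hist n) \<Longrightarrow>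
      ereal \<tau> * KL (\<pi> n z) \<mu> = ereal (U (snd z) - (\<integral>a. Q_real P c \<gamma> U (snd z, a) \<partial>\<pi> n z))"
  shows "V P c \<gamma> \<mu> \<tau> \<pi> s = ereal (U s)"
proof -
  note E = expectation_excess[OF c U \<gamma>]
  have "(\<Sum>n. ereal (\<gamma> ^ n) * (ereal (c (\<omega> n)) + ereal \<tau> * KL (\<pi> n (past n \<omega>, fst (\<omega> n))) \<mu>))
      = ereal (\<Sum>n. \<gamma> ^ n * excess c \<gamma> U n \<omega>)" for \<omega>
    using suminf_ereal'[OF E(1)[of \<omega>]] past_space[of \<omega>]
    by (simp add: eq excess_def add_diff_eq)
  then show ?thesis unfolding V_def by (simp add: eintegral_ereal E)
qed

end

subsection \<open>Occupancy measures and Bellman equations\<close>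

lemma measurable_state_action_kernel:
  fixes P :: "'s::second_countable_topology \<times> 'a::second_countable_topology \<Rightarrow> _"
  shows "P \<in> borel \<rightarrow>\<^sub>M N \<Longrightarrow> (\<lambda>(s, a). P (s, a)) \<in> borel \<Otimes>\<^sub>M borel \<rightarrow>\<^sub>M N"
  by (simp add: borel_prod)

lemma P_pol_kernel:
  fixes P :: "'s::polish_space \<times> 'a::polish_space \<Rightarrow> 's measure"
  assumes "P \<in> borel \<rightarrow>\<^sub>M prob_algebra borel" "\<pi> \<in> borel \<rightarrow>\<^sub>M prob_algebra borel"
  shows "P_pol P \<pi> \<in> borel \<rightarrow>\<^sub>M prob_algebra borel"
  using measurable_bind_prob_space2[OF assms(2), of "\<lambda>s a. P (s, a)"] measurable_state_action_kernel[OF assms(1)]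
  unfolding P_pol_def by simp

lemma P_pol_pow_kernel:
  fixes P :: "'s::polish_space \<times> 'a::polish_space \<Rightarrow> 's measure"
  assumes "P \<in> borel \<rightarrow>\<^sub>M prob_algebra borel" "\<pi> \<in> borel \<rightarrow>\<^sub>M prob_algebra borel"
  shows "P_pol_pow P \<pi> n \<in> borel \<rightarrow>\<^sub>M prob_algebra borel"
proof (induction n)
  case (Suc n)
  from measurable_bind_prob_space[OF this P_pol_kernel[OF assms]] show ?case by simp
qed simp

lemma measure_pmf_in_prob_algebra:
  "measure_pmf p \<in> space (prob_algebra (count_space UNIV))"
  by (simp add: space_prob_algebra measure_pmf.prob_space_axioms)

text \<open>The weights \<open>(1 - \<gamma>) * \<gamma> ^ n\<close> form the geometric
  distribution. The occupancy measure is the corresponding mixture of n-step laws, and its kernel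
  properties follow from those of \<open>bind\<close>.\<close>

lemma occ_eq_bind:
  fixes P :: "'s::polish_space \<times> 'a::polish_space \<Rightarrow> 's measure"
  assumes K: "P \<in> borel \<rightarrow>\<^sub>M prob_algebra borel" "\<pi> \<in> borel \<rightarrow>\<^sub>M prob_algebra borel"
    and \<gamma>: "0 \<le> \<gamma>" "\<gamma> < 1"
  shows "occ P \<gamma> \<pi> s = measure_pmf (geometric_pmf (1 - \<gamma>)) \<bind> (\<lambda>n. P_pol_pow P \<pi> n s)" (is "_ = ?M")
proof -
  have k: "(\<lambda>n. P_pol_pow P \<pi> n s) \<in> count_space UNIV \<rightarrow>\<^sub>M prob_algebra borel"
    using measurable_space[OF P_pol_pow_kernel[OF K]] by auto
  have sets: "sets ?M = sets borel" by (rule sets_bind'[OF measure_pmf_in_prob_algebra k])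
  have em: "emeasure ?M B = ennreal (1 - \<gamma>) * (\<Sum>n. ennreal (\<gamma> ^ n) * emeasure (P_pol_pow P \<pi> n s) B)"
    if "B \<in> sets borel" for B
  proof -
    have "emeasure ?M B = (\<integral>\<^sup>+n. emeasure (P_pol_pow P \<pi> n s) B \<partial>measure_pmf (geometric_pmf (1 - \<gamma>)))"
      by (rule emeasure_bind_prob_algebra[OF measure_pmf_in_prob_algebra k that])
    also have "\<dots> = (\<Sum>n. ennreal (pmf (geometric_pmf (1 - \<gamma>)) n) * emeasure (P_pol_pow P \<pi> n s) B)"
      by (simp add: nn_integral_measure_pmf nn_integral_count_space_nat)
    also have "\<dots> = (\<Sum>n. ennreal (1 - \<gamma>) * (ennreal (\<gamma> ^ n) * emeasure (P_pol_pow P \<pi> n s) B))"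
      using \<gamma> by (intro suminf_cong) (simp add: ennreal_mult mult_ac)
    finally show ?thesis by simp
  qed
  \<comment> \<open>The set function in \<open>occ\<close> agrees on Borel sets with a genuine
    measure, so \<open>measure_of\<close> returns that measure.\<close>
  have "occ P \<gamma> \<pi> s = measure_of UNIV (sets borel) (emeasure ?M)"
    unfolding occ_def by (rule measure_of_eq) (auto simp: em sets.sigma_sets_eq[of borel, simplified])
  also have "\<dots> = ?M"
    using measure_of_of_measure[of ?M] sets sets_eq_imp_space_eq[OF sets] by simp
  finally show ?thesis .
qed

lemma occ_kernel:
  fixes P :: "'s::polish_space \<times> 'a::polish_space \<Rightarrow> 's measure"
  assumes K: "P \<in> borel \<rightarrow>\<^sub>M prob_algebra borel" "\<pi> \<in> borel \<rightarrow>\<^sub>M prob_algebra borel"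
    and \<gamma>: "0 \<le> \<gamma>" "\<gamma> < 1"
  shows "occ P \<gamma> \<pi> \<in> borel \<rightarrow>\<^sub>M prob_algebra borel"
proof -
  have "(\<lambda>(s, n). P_pol_pow P \<pi> n s) \<in> borel \<Otimes>\<^sub>M count_space UNIV \<rightarrow>\<^sub>M prob_algebra borel"
    unfolding case_prod_beta'
    by (rule measurable_compose_countable[where f="\<lambda>n z. P_pol_pow P \<pi> n (fst z)" and g=snd])
       (auto intro: measurable_compose[OF measurable_fst P_pol_pow_kernel[OF K]])
  from measurable_bind_prob_space2[OF measurable_const[OF measure_pmf_in_prob_algebra] this]
  show ?thesis using occ_eq_bind[OF K \<gamma>] by (simp cong: measurable_cong)
qed

text \<open>\<open>D\<close> solves a linear Bellman equation with source \<open>h\<close>.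
  Substituting it under each n-step law makes the discounted sum of the integrals of
  \<open>h\<close> telescope to \<open>D s\<close>; the factor \<open>1 - \<gamma>\<close>
  normalises the occupancy measure.\<close>

lemma integral_occ:
  fixes P :: "'s::polish_space \<times> 'a::polish_space \<Rightarrow> 's measure"
  assumes K: "P \<in> borel \<rightarrow>\<^sub>M prob_algebra borel" "\<pi> \<in> borel \<rightarrow>\<^sub>M prob_algebra borel"
    and \<gamma>: "0 \<le> \<gamma>" "\<gamma> < 1" and h: "h \<in> Bb" and D: "D \<in> Bb"
    and eq: "\<And>s. D s = h s + \<gamma> * (\<integral>s'. D s' \<partial>P_pol P \<pi> s)"
  shows "(\<integral>s'. h s' \<partial>occ P \<gamma> \<pi> s) = (1 - \<gamma>) * D s"
proof -
  note PK = P_pol_kernel[OF K] and PnK = P_pol_pow_kernel[OF K]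
  have Prob: "P_pol_pow P \<pi> n s \<in> Prob" for n by (rule Prob_kernel[OF PnK]) simp
  obtain Bh where Bh: "\<And>x. \<bar>h x\<bar> \<le> Bh" using h by (rule Bb_boundE) blast
  obtain BD where BD: "\<And>x. \<bar>D x\<bar> \<le> BD" using D by (rule Bb_boundE) blast
  define e where "e n = (\<integral>s'. D s' \<partial>P_pol_pow P \<pi> n s)" for n
  define f where "f n = (\<integral>s'. h s' \<partial>P_pol_pow P \<pi> n s)" for n
  have fe: "f n = e n - \<gamma> * e (Suc n)" for n
  proof -
    have PD: "(\<lambda>x. \<gamma> * (\<integral>s'. D s' \<partial>P_pol P \<pi> x)) \<in> Bb"
      by (intro Bb_cmult Bb_integral_kernel'[OF PK D])
    have "e n = (\<integral>x. h x + \<gamma> * (\<integral>s'. D s' \<partial>P_pol P \<pi> x) \<partial>P_pol_pow P \<pi> n s)"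
      unfolding e_def by (rule Bochner_Integration.integral_cong[OF refl eq])
    also have "\<dots> = f n + \<gamma> * (\<integral>x. (\<integral>s'. D s' \<partial>P_pol P \<pi> x) \<partial>P_pol_pow P \<pi> n s)"
      unfolding f_def by (simp add: Prob_integral_add[OF Prob h PD])
    finally have "e n = f n + \<gamma> * (\<integral>x. (\<integral>s'. D s' \<partial>P_pol P \<pi> x) \<partial>P_pol_pow P \<pi> n s)" .
    moreover have "e (Suc n) = (\<integral>x. (\<integral>s'. D s' \<partial>P_pol P \<pi> x) \<partial>P_pol_pow P \<pi> n s)"
      unfolding e_def by (simp add: Prob_integral_bind[OF Prob PK D])
    ultimately show ?thesis by simp
  qed
  have k: "(\<lambda>n. P_pol_pow P \<pi> n s) \<in> count_space UNIV \<rightarrow>\<^sub>M prob_algebra borel"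
    using measurable_space[OF PnK] by auto
  let ?p = "geometric_pmf (1 - \<gamma>)"
  have occ: "(\<integral>s'. h s' \<partial>occ P \<gamma> \<pi> s) = (\<integral>n. f n \<partial>measure_pmf ?p)"
    unfolding occ_eq_bind[OF K \<gamma>] f_def using Bb_measurable[OF h] Bh
    by (intro integral_bind_prob[OF _ _ k]) (auto simp: measure_pmf.prob_space_axioms)
  have sums1: "(\<lambda>n. pmf ?p n * f n) sums (\<integral>n. f n \<partial>measure_pmf ?p)"
  proof -
    have "\<bar>f n\<bar> \<le> Bh" for n unfolding f_def by (rule Prob_integral_bound[OF Prob Bh])
    then have "integrable (measure_pmf ?p) f"
      by (intro measure_pmf.integrable_const_bound[of _ Bh]) auto
    then have "integrable (count_space UNIV) (\<lambda>n. pmf ?p n * f n)"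
      unfolding measure_pmf_eq_density by (subst (asm) integrable_density) auto
    from sums_integral_count_space_nat[OF this] show ?thesis
      unfolding measure_pmf_eq_density by (subst integral_density) auto
  qed
  have sums2: "(\<lambda>n. pmf ?p n * f n) sums ((1 - \<gamma>) * (\<gamma> ^ 0 * e 0 - 0))"
  proof -
    have e_bound: "\<bar>e n\<bar> \<le> BD" for n unfolding e_def by (rule Prob_integral_bound[OF Prob BD])
    have "(\<lambda>n. \<gamma> ^ n * e n) \<longlonglongrightarrow> 0"
    proof (rule Lim_null_comparison[OF always_eventually[OF allI]])
      show "norm (\<gamma> ^ n * e n) \<le> \<gamma> ^ n * BD" for n
        using e_bound[of n] \<gamma> by (simp add: abs_mult mult_left_mono)
      have "(\<lambda>n. \<gamma> ^ n * BD) \<longlonglongrightarrow> 0 * BD"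
        by (intro tendsto_mult tendsto_const LIMSEQ_power_zero) (use \<gamma> in auto)
      then show "(\<lambda>n. \<gamma> ^ n * BD) \<longlonglongrightarrow> 0" by simp
    qed
    from sums_mult[OF telescope_sums'[OF this], of "1 - \<gamma>"]
    show ?thesis using \<gamma> by (simp add: fe algebra_simps)
  qed
  have "(\<integral>s'. h s' \<partial>occ P \<gamma> \<pi> s) = (1 - \<gamma>) * e 0"
    using sums_unique2[OF sums1 sums2] occ by simp
  also have "e 0 = D s" unfolding e_def by (simp add: integral_return Bb_measurable[OF D])
  finally show ?thesis .
qed

lemma occ_init_Prob:
  fixes P :: "'s::polish_space \<times> 'a::polish_space \<Rightarrow> 's measure"
  assumes K: "P \<in> borel \<rightarrow>\<^sub>M prob_algebra borel" "\<pi> \<in> borel \<rightarrow>\<^sub>M prob_algebra borel"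
    and \<gamma>: "0 \<le> \<gamma>" "\<gamma> < 1" and \<rho>: "\<rho> \<in> Prob"
  shows "occ_init P \<gamma> \<pi> \<rho> \<in> Prob"
  unfolding occ_init_def by (rule Prob_bind[OF \<rho> occ_kernel[OF K \<gamma>]])

lemma integral_occ_init:
  fixes P :: "'s::polish_space \<times> 'a::polish_space \<Rightarrow> 's measure"
  assumes K: "P \<in> borel \<rightarrow>\<^sub>M prob_algebra borel" "\<pi> \<in> borel \<rightarrow>\<^sub>M prob_algebra borel"
    and \<gamma>: "0 \<le> \<gamma>" "\<gamma> < 1" and \<rho>: "\<rho> \<in> Prob" and h: "h \<in> Bb" and D: "D \<in> Bb"
    and eq: "\<And>s. D s = h s + \<gamma> * (\<integral>s'. D s' \<partial>P_pol P \<pi> s)"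
  shows "(\<integral>s'. h s' \<partial>occ_init P \<gamma> \<pi> \<rho>) = (1 - \<gamma>) * (\<integral>s. D s \<partial>\<rho>)"
  unfolding occ_init_def
  by (simp add: Prob_integral_bind[OF \<rho> occ_kernel[OF K \<gamma>] h] integral_occ[OF K \<gamma> h D eq])

section \<open>Normalised log-densities and the policies they generate\<close>

locale entropy_mdp =
  fixes P :: "'s::polish_space \<times> 'a::polish_space \<Rightarrow> 's measure"
    and c :: "'s \<times> 'a \<Rightarrow> real" and \<gamma> \<tau> :: real and \<mu> :: "'a measure"
  assumes P: "P \<in> borel \<rightarrow>\<^sub>M prob_algebra borel" and c: "c \<in> Bb"
    and \<gamma>: "0 \<le> \<gamma>" "\<gamma> < 1" and \<mu>: "\<mu> \<in> Prob" and \<tau>: "0 < \<tau>"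
begin

text \<open>The log-partition function of \<open>f\<close>. At
  \<open>- (1 / \<tau>) * Q u x\<close>, and multiplied by \<open>- \<tau>\<close>, it is the soft
  Bellman operator of \<open>optimal_exists\<close>.\<close>

definition log_mean :: "('s \<times> 'a \<Rightarrow> real) \<Rightarrow> 's \<Rightarrow> real" where
  "log_mean f s = ln (\<integral>a. exp (f (s, a)) \<partial>\<mu>)"

definition log_densities :: "('s \<times> 'a \<Rightarrow> real) set" where
  "log_densities = {l \<in> Bb. \<forall>s. (\<integral>a. exp (l (s, a)) \<partial>\<mu>) = 1}"

definition pol :: "('s \<times> 'a \<Rightarrow> real) \<Rightarrow> 's \<Rightarrow> 'a measure" where
  "pol l s = exp_density \<mu> (\<lambda>a. l (s, a))"

abbreviation Q :: "('s \<Rightarrow> real) \<Rightarrow> 's \<times> 'a \<Rightarrow> real" where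
  "Q \<equiv> Q_real P c \<gamma>"

lemma log_densitiesD:
  "l \<in> log_densities \<Longrightarrow> l \<in> Bb" "l \<in> log_densities \<Longrightarrow> (\<integral>a. exp (l (s, a)) \<partial>\<mu>) = 1"
  by (auto simp: log_densities_def)

lemma integral_mu_kernel_Bb: "f \<in> Bb \<Longrightarrow> (\<lambda>s. \<integral>a. f (s, a) \<partial>\<mu>) \<in> Bb" for f :: "'s \<times> 'a \<Rightarrow> real"
  using \<mu> by (intro Bb_integral_kernel) (auto simp: Prob_def)

lemma exp_integral_bounds:
  fixes f :: "'s \<times> 'a \<Rightarrow> real"
  assumes f: "f \<in> Bb" and B: "\<And>a. \<bar>f (s, a)\<bar> \<le> B"
  shows "exp (- B) \<le> (\<integral>a. exp (f (s, a)) \<partial>\<mu>)" "(\<integral>a. exp (f (s, a)) \<partial>\<mu>) \<le> exp B"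
proof -
  have b: "- B \<le> f (s, a)" "f (s, a) \<le> B" for a using B[of a] by linarith+
  have "(\<integral>a. exp (- B) \<partial>\<mu>) \<le> (\<integral>a. exp (f (s, a)) \<partial>\<mu>)"
    by (rule Prob_integral_mono[OF \<mu>]) (auto intro!: Bb_intros f b)
  then show "exp (- B) \<le> (\<integral>a. exp (f (s, a)) \<partial>\<mu>)" by (simp only: Prob_integral_const[OF \<mu>])
  have "(\<integral>a. exp (f (s, a)) \<partial>\<mu>) \<le> (\<integral>a. exp B \<partial>\<mu>)"
    by (rule Prob_integral_mono[OF \<mu>]) (auto intro!: Bb_intros f b)
  then show "(\<integral>a. exp (f (s, a)) \<partial>\<mu>) \<le> exp B" by (simp only: Prob_integral_const[OF \<mu>])
qed

lemma exp_integral_pos: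
  fixes f :: "'s \<times> 'a \<Rightarrow> real"
  assumes f: "f \<in> Bb" shows "0 < (\<integral>a. exp (f (s, a)) \<partial>\<mu>)"
proof -
  obtain B where "\<And>x. \<bar>f x\<bar> \<le> B" using f by (rule Bb_boundE) blast
  from exp_integral_bounds(1)[OF f this] show ?thesis by (rule less_le_trans[OF exp_gt_zero])
qed

lemma log_mean_Bb:
  assumes f: "f \<in> Bb" shows "log_mean f \<in> Bb"
proof -
  obtain B where B: "\<And>x. \<bar>f x\<bar> \<le> B" using f by (rule Bb_boundE) blast
  have "(\<lambda>s. \<integral>a. exp (f (s, a)) \<partial>\<mu>) \<in> borel_measurable borel"
    by (intro Bb_measurable integral_mu_kernel_Bb Bb_exp f)
  then have "log_mean f \<in> borel_measurable borel" unfolding log_mean_def by measurable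
  moreover have "\<bar>log_mean f s\<bar> \<le> B" for s
  proof -
    let ?I = "\<integral>a. exp (f (s, a)) \<partial>\<mu>"
    have "ln (exp (- B)) \<le> ln ?I" "ln ?I \<le> ln (exp B)"
      by (subst ln_le_cancel_iff; simp add: exp_integral_pos[OF f] exp_integral_bounds[OF f B])+
    then show ?thesis unfolding log_mean_def by simp
  qed
  ultimately show ?thesis by (rule BbI)
qed

lemma exp_log_mean: "f \<in> Bb \<Longrightarrow> exp (log_mean f s) = (\<integral>a. exp (f (s, a)) \<partial>\<mu>)"
  unfolding log_mean_def by (simp add: exp_integral_pos)

text \<open>\<open>log_mean\<close> is monotone and additive constants pass through it, hence it is
  nonexpansive in the sup norm.\<close>

lemma log_mean_contraction:
  assumes f: "f \<in> Bb" and g: "g \<in> Bb" and K: "\<And>x. \<bar>f x - g x\<bar> \<le> K"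
  shows "\<bar>log_mean f s - log_mean g s\<bar> \<le> K"
proof -
  have le: "log_mean f s \<le> K + log_mean g s"
    if f: "f \<in> Bb" and g: "g \<in> Bb" and K: "\<And>x. f x \<le> K + g x" for f g
  proof -
    have "(\<integral>a. exp (f (s, a)) \<partial>\<mu>) \<le> (\<integral>a. exp K * exp (g (s, a)) \<partial>\<mu>)"
      by (rule Prob_integral_mono[OF \<mu>]) (auto intro!: Bb_intros f g simp: K exp_add[symmetric])
    then have "exp (log_mean f s) \<le> exp (K + log_mean g s)"
      by (simp add: exp_log_mean f g exp_add)
    then show ?thesis by simp
  qed
  have "f x \<le> K + g x" "g x \<le> K + f x" for x using K[of x] by linarith+
  from le[OF f g this(1)] le[OF g f this(2)] show ?thesis by linarith
qed

lemma normalise_log_density: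
  assumes f: "f \<in> Bb" shows "(\<lambda>x. f x - log_mean f (fst x)) \<in> log_densities"
proof -
  have "(\<integral>a. exp (f (s, a) - log_mean f s) \<partial>\<mu>) = 1" for s
    using exp_integral_pos[OF f, of s] by (simp add: exp_diff exp_log_mean[OF f])
  then show ?thesis
    unfolding log_densities_def by (auto intro!: Bb_intros f log_mean_Bb)
qed

lemma gibbs_eq_pol: "f \<in> Bb \<Longrightarrow> gibbs \<mu> f = pol (\<lambda>x. f x - log_mean f (fst x))"
  by (simp add: fun_eq_iff gibbs_def pol_def exp_density_def exp_diff exp_log_mean)

lemma pol_Prob: "l \<in> log_densities \<Longrightarrow> pol l s \<in> Prob"
  unfolding pol_def by (intro exp_density_Prob[OF \<mu>] Bb_Pair log_densitiesD)

lemma pol_kernel: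
  assumes l: "l \<in> log_densities" shows "pol l \<in> borel \<rightarrow>\<^sub>M prob_algebra borel"
proof (rule measurable_prob_algebraI)
  show prob: "prob_space (pol l s)" for s by (rule ProbD[OF pol_Prob[OF l]])
  interpret \<mu>: prob_space \<mu> by (rule ProbD[OF \<mu>])
  have s: "sets \<mu> = sets borel" by (rule ProbD[OF \<mu>])
  note [measurable_cong] = s
  have l': "l \<in> borel_measurable (borel \<Otimes>\<^sub>M \<mu>)"
    using Bb_measurable[OF log_densitiesD(1)[OF l]] unfolding borel_prod[symmetric]
    by (simp cong: measurable_cong_sets)
  note [measurable] = l'
  show "pol l \<in> borel \<rightarrow>\<^sub>M subprob_algebra borel"
  proof (rule measurable_subprob_algebra)
    show "subprob_space (pol l s)" for s by (rule prob_space_imp_subprob_space[OF prob])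
    show "sets (pol l s) = sets borel" for s by (rule ProbD[OF pol_Prob[OF l]])
    fix A :: "'a set" assume [measurable]: "A \<in> sets borel"
    have [measurable]: "(\<lambda>a. l (s, a)) \<in> borel_measurable \<mu>" for s by measurable
    have "emeasure (pol l s) A = (\<integral>\<^sup>+a. ennreal (exp (l (s, a))) * indicator A a \<partial>\<mu>)" for s
      unfolding pol_def exp_density_def by (rule emeasure_density) (auto simp: s)
    moreover have "(\<lambda>s. \<integral>\<^sup>+a. ennreal (exp (l (s, a))) * indicator A a \<partial>\<mu>) \<in> borel_measurable borel"
      by measurable
    ultimately show "(\<lambda>s. emeasure (pol l s) A) \<in> borel_measurable borel" by simp
  qed
qed

definition avg :: "('s \<times> 'a \<Rightarrow> real) \<Rightarrow> ('s \<times> 'a \<Rightarrow> real) \<Rightarrow> 's \<Rightarrow> real" where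
  "avg l g s = (\<integral>a. g (s, a) \<partial>pol l s)"

lemma avg_Bb: "l \<in> log_densities \<Longrightarrow> g \<in> Bb \<Longrightarrow> avg l g \<in> Bb"
  unfolding avg_def by (intro Bb_integral_kernel pol_kernel)

context
  fixes l assumes l: "l \<in> log_densities"
begin

lemma avg_add: "f \<in> Bb \<Longrightarrow> g \<in> Bb \<Longrightarrow> avg l (\<lambda>x. f x + g x) s = avg l f s + avg l g s"
  and avg_diff: "f \<in> Bb \<Longrightarrow> g \<in> Bb \<Longrightarrow> avg l (\<lambda>x. f x - g x) s = avg l f s - avg l g s"
  unfolding avg_def by (simp_all add: Prob_integral_add Prob_integral_diff pol_Prob[OF l] Bb_Pair)

lemma avg_cmult: "avg l (\<lambda>x. k * f x) s = k * avg l f s"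
  unfolding avg_def by simp

lemma avg_state: "avg l (\<lambda>x. k (fst x)) s = k s"
  using Prob_integral_const[OF pol_Prob[OF l]] unfolding avg_def by simp

lemma avg_bound: "(\<And>x. \<bar>f x\<bar> \<le> B) \<Longrightarrow> \<bar>avg l f s\<bar> \<le> B"
  unfolding avg_def by (rule Prob_integral_bound[OF pol_Prob[OF l]])

lemma integral_P_pol:
  "v \<in> Bb \<Longrightarrow> (\<integral>s'. v s' \<partial>P_pol P (pol l) s) = avg l (\<lambda>x. \<integral>s'. v s' \<partial>P x) s"
proof -
  assume v: "v \<in> Bb"
  have "(Pair s :: 'a \<Rightarrow> _) \<in> borel \<rightarrow>\<^sub>M borel \<Otimes>\<^sub>M borel" by measurable
  then have "(Pair s :: 'a \<Rightarrow> _) \<in> borel \<rightarrow>\<^sub>M borel" by (simp only: borel_prod)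
  from measurable_compose[OF this P] show ?thesis
    unfolding P_pol_def avg_def by (rule Prob_integral_bind[OF pol_Prob[OF l] _ v])
qed

lemma KL_pol_base: "KL (pol l s) \<mu> = ereal (avg l l s)"
  unfolding pol_def avg_def by (rule KL_exp_density_base[OF \<mu> Bb_Pair[OF log_densitiesD(1)[OF l]] log_densitiesD(2)[OF l]])

lemma KL_pol: "l' \<in> log_densities \<Longrightarrow> KL (pol l s) (pol l' s) = ereal (avg l (\<lambda>x. l x - l' x) s)"
  unfolding pol_def avg_def
  by (rule KL_exp_density[OF \<mu> Bb_Pair[OF log_densitiesD(1)[OF l]] log_densitiesD(2)[OF l]])
     (auto intro: Bb_Pair log_densitiesD)

text \<open>Nonnegativity of relative entropy: the case of zero log-density in
  \<open>KL_ge_integral\<close>, with \<open>pol l' s\<close> as reference measure.\<close>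

lemma avg_log_ratio_nonneg: "l' \<in> log_densities \<Longrightarrow> 0 \<le> avg l (\<lambda>x. l x - l' x) s"
proof -
  assume l': "l' \<in> log_densities"
  have "ereal (\<integral>a. 0 \<partial>pol l s) \<le> KL (pol l s) (pol l' s)"
    by (rule KL_ge_integral[OF pol_Prob[OF l'] pol_Prob[OF l] Bb_const])
       (simp add: prob_space.prob_space[OF ProbD(2)[OF pol_Prob[OF l']]])
  then show ?thesis unfolding KL_pol[OF l'] by simp
qed

end

section \<open>Bellman fixed points and the optimal value\<close>

lemma Q_Bb: "v \<in> Bb \<Longrightarrow> Q v \<in> Bb"
  by (rule Q_real_Bb[OF P c])

lemma Q_contraction:
  assumes "u \<in> Bb" "v \<in> Bb" "\<And>x. \<bar>u x - v x\<bar> \<le> K"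
  shows "\<bar>Q u x - Q v x\<bar> \<le> \<gamma> * K"
proof -
  have Px: "P x \<in> Prob" by (rule Prob_kernel[OF P]) simp
  have "Q u x - Q v x = \<gamma> * (\<integral>s'. u s' - v s' \<partial>P x)"
    unfolding Q_real_def by (simp add: Prob_integral_diff[OF Px] assms algebra_simps)
  moreover have "\<bar>\<integral>s'. u s' - v s' \<partial>P x\<bar> \<le> K" by (rule Prob_integral_bound[OF Px assms(3)])
  ultimately show ?thesis using \<gamma> by (simp add: abs_mult mult_left_mono)
qed

lemma bellman_Q_real: "v \<in> Bb \<Longrightarrow> bellman_Q P c \<gamma> (\<lambda>s. ereal (v s)) x = ereal (Q v x)"
  unfolding bellman_Q_def Q_real_def
  using Prob_eintegral[of "P x" v] Prob_kernel[OF P, of x] by simp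

lemma stationary_policies: "l \<in> log_densities \<Longrightarrow> stationary (pol l) \<in> policies"
  unfolding policies_def stationary_def hist_space_def
  by (auto simp: case_prod_beta' intro!: measurable_compose[OF measurable_snd] pol_kernel)

text \<open>The relative entropy of \<open>pol l\<close> from \<open>\<mu>\<close> is the average of
  \<open>l\<close>, so the Bellman equation rearranges to the hypothesis of
  \<open>V_eq\<close>.\<close>

lemma V_stat_eqI:
  assumes l: "l \<in> log_densities" and v: "v \<in> Bb"
    and eq: "\<And>s. v s = avg l (\<lambda>x. Q v x + \<tau> * l x) s"
  shows "V_stat P c \<gamma> \<mu> \<tau> (pol l) = (\<lambda>s. ereal (v s))"
proof
  fix s
  interpret trajectory P "stationary (pol l)" s
    by unfold_locales (rule P, rule stationary_policies[OF l])
  have eq': "\<tau> * avg l l s = v s - avg l (Q v) s" for s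
    using eq[of s] by (simp add: avg_add[OF l] avg_cmult[OF l] Bb_cmult log_densitiesD[OF l] Q_Bb[OF v])
  show "V P c \<gamma> \<mu> \<tau> (stationary (pol l)) s = ereal (v s)"
    by (rule V_eq[OF c v \<gamma>])
       (auto simp: stationary_def case_prod_beta' KL_pol_base[OF l] eq' avg_def[symmetric])
qed

lemma V_stat_exists:
  assumes l: "l \<in> log_densities"
  obtains v where "v \<in> Bb" "\<And>s. v s = avg l (\<lambda>x. Q v x + \<tau> * l x) s"
    "V_stat P c \<gamma> \<mu> \<tau> (pol l) = (\<lambda>s. ereal (v s))"
proof -
  obtain v where v: "v \<in> Bb" "(\<lambda>u. avg l (\<lambda>x. Q u x + \<tau> * l x)) v = v"
  proof (rule Bb_contraction_fixpoint[OF \<gamma>, of "\<lambda>u. avg l (\<lambda>x. Q u x + \<tau> * l x)"])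
    fix u v :: "'s \<Rightarrow> real" and K s
    assume uv: "u \<in> Bb" "v \<in> Bb" "\<And>x. \<bar>u x - v x\<bar> \<le> K"
    \<comment> \<open>The entropy term does not depend on the value function and cancels; the
      contraction comes from \<open>Q\<close> alone.\<close>
    have "avg l (\<lambda>x. Q u x + \<tau> * l x) s - avg l (\<lambda>x. Q v x + \<tau> * l x) s = avg l (\<lambda>x. Q u x - Q v x) s"
      by (subst avg_diff[OF l, symmetric]) (simp_all add: Bb_add Bb_cmult Q_Bb uv log_densitiesD(1)[OF l])
    moreover have "\<bar>avg l (\<lambda>x. Q u x - Q v x) s\<bar> \<le> \<gamma> * K"
      by (rule avg_bound[OF l]) (rule Q_contraction[OF uv])
    ultimately show "\<bar>avg l (\<lambda>x. Q u x + \<tau> * l x) s - avg l (\<lambda>x. Q v x + \<tau> * l x) s\<bar> \<le> \<gamma> * K"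
      by simp
  qed (intro avg_Bb[OF l] Bb_add Bb_cmult Q_Bb log_densitiesD(1)[OF l])
  from v(2) have eq: "v s = avg l (\<lambda>x. Q v x + \<tau> * l x) s" for s by (simp add: fun_eq_iff)
  from that[OF v(1) eq V_stat_eqI[OF l v(1) eq]] show thesis .
qed

text \<open>The exponent in \<open>pi_opt\<close> when \<open>w\<close> is the optimal
  value.\<close>

definition l_opt :: "('s \<Rightarrow> real) \<Rightarrow> 's \<times> 'a \<Rightarrow> real" where
  "l_opt w x = (w (fst x) - Q w x) / \<tau>"

text \<open>\<open>w\<close> is the fixed point of the soft Bellman operator. The stationary policy
  with log-density \<open>l_opt w\<close> attains it, and the Gibbs inequality with that same
  log-density makes it a lower bound for every policy.\<close>

lemma optimal_exists:
  obtains w where "w \<in> Bb" "l_opt w \<in> log_densities" "V_opt P c \<gamma> \<mu> \<tau> = (\<lambda>s. ereal (w s))"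
    "\<And>s. w s = avg (l_opt w) (\<lambda>x. Q w x + \<tau> * l_opt w x) s" "pi_opt P c \<gamma> \<mu> \<tau> = pol (l_opt w)"
proof -
  let ?f = "\<lambda>u x. - (1 / \<tau>) * Q u x"
  note f_Bb = Bb_cmult[OF Q_Bb]
  obtain w where w: "w \<in> Bb" "(\<lambda>s. - \<tau> * log_mean (?f w) s) = w"
  proof (rule Bb_contraction_fixpoint[OF \<gamma>, of "\<lambda>u s. - \<tau> * log_mean (?f u) s"])
    fix u v :: "'s \<Rightarrow> real" and K s
    assume uv: "u \<in> Bb" "v \<in> Bb" "\<And>x. \<bar>u x - v x\<bar> \<le> K"
    have "\<bar>?f u x - ?f v x\<bar> \<le> \<gamma> * K / \<tau>" for x
    proof -
      have "?f u x - ?f v x = - (Q u x - Q v x) / \<tau>" by (simp add: algebra_simps diff_divide_distrib)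
      then show ?thesis using Q_contraction[OF uv, of x] \<tau> by (simp add: divide_right_mono)
    qed
    from log_mean_contraction[OF f_Bb[OF uv(1)] f_Bb[OF uv(2)] this, of s]
    have "\<tau> * \<bar>log_mean (?f u) s - log_mean (?f v) s\<bar> \<le> \<tau> * (\<gamma> * K / \<tau>)"
      using \<tau> by (intro mult_left_mono) auto
    moreover have "- \<tau> * log_mean (?f u) s - - \<tau> * log_mean (?f v) s =
        - (\<tau> * (log_mean (?f u) s - log_mean (?f v) s))" by (simp add: algebra_simps)
    ultimately show "\<bar>- \<tau> * log_mean (?f u) s - - \<tau> * log_mean (?f v) s\<bar> \<le> \<gamma> * K"
      using \<tau> by (simp add: abs_mult)
  qed (intro Bb_cmult log_mean_Bb Q_Bb)
  let ?l = "l_opt w"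
  \<comment> \<open>By the fixed-point equation \<open>w / \<tau>\<close> is minus the log-partition
    function, which is the normalisation needed for \<open>l_opt w\<close>.\<close>
  have "?f w x - log_mean (?f w) (fst x) = ?l x" for x
    using fun_cong[OF w(2), of "fst x"] \<tau> unfolding l_opt_def by (simp add: field_simps)
  with normalise_log_density[OF f_Bb[OF w(1)], of "- (1 / \<tau>)"]
  have l: "?l \<in> log_densities" by (simp add: fun_eq_iff[symmetric] eta_contract_eq)
  \<comment> \<open>This sum is constant in the action, so averaging it gives \<open>w\<close> and
    hence the Bellman equation of \<open>pol ?l\<close>.\<close>
  have Ql: "Q w x + \<tau> * ?l x = w (fst x)" for x using \<tau> by (simp add: l_opt_def)
  have eq: "w s = avg ?l (\<lambda>x. Q w x + \<tau> * ?l x) s" for s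
    unfolding Ql by (rule avg_state[OF l, symmetric])
  have V: "V_opt P c \<gamma> \<mu> \<tau> s = ereal (w s)" for s
  proof (rule antisym)
    show "V_opt P c \<gamma> \<mu> \<tau> s \<le> ereal (w s)"
      unfolding V_opt_def using V_stat_eqI[OF l w(1) eq] stationary_policies[OF l]
      by (intro INF_lower2[of "stationary (pol ?l)"]) (auto simp: fun_eq_iff)
    show "ereal (w s) \<le> V_opt P c \<gamma> \<mu> \<tau> s"
      unfolding V_opt_def
    proof (rule INF_greatest)
      fix \<pi> :: "nat \<Rightarrow> (nat \<Rightarrow> 's \<times> 'a) \<times> 's \<Rightarrow> 'a measure" assume \<pi>: "\<pi> \<in> policies"
      interpret trajectory P \<pi> s by unfold_locales (rule P, rule \<pi>)
      show "ereal (w s) \<le> V P c \<gamma> \<mu> \<tau> \<pi> s"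
      proof (rule V_ge[OF c w(1) \<gamma>])
        fix n and z :: "(nat \<Rightarrow> 's \<times> 'a) \<times> 's" assume "fst z \<in> space (hist n)"
        then have m: "\<pi> n z \<in> Prob"
          using Prob_kernel[OF policies_kernel[OF \<pi>], of "fst z" n "snd z"] by simp
        have "ereal (\<integral>a. ?l (snd z, a) \<partial>\<pi> n z) \<le> KL (\<pi> n z) \<mu>"
          by (rule KL_ge_integral[OF \<mu> m Bb_Pair[OF log_densitiesD(1)[OF l]] log_densitiesD(2)[OF l]])
        then have "ereal \<tau> * ereal (\<integral>a. ?l (snd z, a) \<partial>\<pi> n z) \<le> ereal \<tau> * KL (\<pi> n z) \<mu>"
          using \<tau> by (intro ereal_mult_left_mono) auto
        \<comment> \<open>Multiplication by \<open>\<tau>\<close> turns \<open>?l\<close> into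
          \<open>w - Q w\<close>, so the Gibbs inequality becomes the condition of
          \<open>V_ge\<close>.\<close>
        moreover have "\<tau> * (\<integral>a. ?l (snd z, a) \<partial>\<pi> n z) = (\<integral>a. w (snd z) - Q w (snd z, a) \<partial>\<pi> n z)"
          using \<tau> by (simp add: l_opt_def)
        moreover have "\<dots> = w (snd z) - (\<integral>a. Q w (snd z, a) \<partial>\<pi> n z)"
          by (simp only: Prob_integral_diff[OF m Bb_const Bb_Pair[OF Q_Bb[OF w(1)]]] Prob_integral_const[OF m])
        ultimately show "ereal (w (snd z) - (\<integral>a. Q w (snd z, a) \<partial>\<pi> n z)) \<le> ereal \<tau> * KL (\<pi> n z) \<mu>"
          by simp
      qed
    qed
  qed
  then have V': "V_opt P c \<gamma> \<mu> \<tau> = (\<lambda>s. ereal (w s))" by auto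
  have "pi_opt P c \<gamma> \<mu> \<tau> = pol ?l"
  proof
    fix s
    have "- (1 / \<tau>) * real_of_ereal (ereal (Q w (s, a)) - ereal (w s)) = ?l (s, a)" for a
      using \<tau> by (simp add: l_opt_def field_simps)
    then show "pi_opt P c \<gamma> \<mu> \<tau> s = pol ?l s"
      unfolding pi_opt_def Q_opt_def V' bellman_Q_real[OF w(1)] pol_def exp_density_def by simp
  qed
  from that[OF w(1) l V' eq this] show thesis .
qed

end

subsection \<open>Mirror descent steps\<close>

context entropy_mdp
begin

definition val :: "('s \<times> 'a \<Rightarrow> real) \<Rightarrow> 's \<Rightarrow> real" where
  "val l s = real_of_ereal (V_stat P c \<gamma> \<mu> \<tau> (pol l) s)"

lemma val_Bb: "l \<in> log_densities \<Longrightarrow> val l \<in> Bb"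
  and val_eq: "l \<in> log_densities \<Longrightarrow> val l s = avg l (\<lambda>x. Q (val l) x + \<tau> * l x) s"
  and V_stat_val: "l \<in> log_densities \<Longrightarrow> V_stat P c \<gamma> \<mu> \<tau> (pol l) = (\<lambda>s. ereal (val l s))"
proof -
  assume l: "l \<in> log_densities"
  obtain v where v: "v \<in> Bb" "\<And>s. v s = avg l (\<lambda>x. Q v x + \<tau> * l x) s"
    "V_stat P c \<gamma> \<mu> \<tau> (pol l) = (\<lambda>s. ereal (v s))" by (rule V_stat_exists[OF l]) blast
  have "val l = v" by (rule ext) (simp add: val_def v(3))
  with v show "val l \<in> Bb" "val l s = avg l (\<lambda>x. Q (val l) x + \<tau> * l x) s"
    "V_stat P c \<gamma> \<mu> \<tau> (pol l) = (\<lambda>s. ereal (val l s))" by simp_all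
qed

text \<open>The flat derivative \<open>dV\<close> at \<open>pol l\<close>, with the given
  log-density in place of the version chosen by \<open>RN_deriv\<close>.\<close>

definition adv :: "('s \<times> 'a \<Rightarrow> real) \<Rightarrow> 's \<times> 'a \<Rightarrow> real" where
  "adv l x = Q (val l) x + \<tau> * l x - val l (fst x)"

lemma adv_Bb: "l \<in> log_densities \<Longrightarrow> adv l \<in> Bb"
  unfolding adv_def by (intro Bb_add Bb_diff Bb_cmult Bb_fst Q_Bb val_Bb log_densitiesD(1))

lemma avg_adv:
  assumes l: "l \<in> log_densities"
  shows "avg l (adv l) s = 0"
proof -
  have "avg l (adv l) s = avg l (\<lambda>x. Q (val l) x + \<tau> * l x) s - avg l (\<lambda>x. val l (fst x)) s"
    unfolding adv_def
    by (rule avg_diff[OF l]) (intro Bb_add Bb_cmult Bb_fst Q_Bb val_Bb l log_densitiesD(1))+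
  then show ?thesis using val_eq[OF l, of s] by (simp add: avg_state[OF l])
qed

text \<open>One-step performance difference identity, in the form of the linear equation that
  \<open>integral_occ\<close> solves.\<close>

lemma val_difference:
  assumes l: "l \<in> log_densities" and l': "l' \<in> log_densities"
  shows "val l' s - val l s = avg l' (\<lambda>x. adv l x + \<tau> * (l' x - l x)) s
    + \<gamma> * (\<integral>s'. val l' s' - val l s' \<partial>P_pol P (pol l') s)"
proof -
  note B = Bb_add Bb_diff Bb_cmult Bb_fst Q_Bb val_Bb[OF l] val_Bb[OF l'] l l' log_densitiesD(1)
  have D: "(\<lambda>s. val l' s - val l s) \<in> Bb" by (intro B)
  \<comment> \<open>The discounted value difference replaces \<open>Q (val l)\<close> by
    \<open>Q (val l')\<close>, and the log-ratio term replaces \<open>\<tau> * l\<close> by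
    \<open>\<tau> * l'\<close>.\<close>
  have eq: "adv l x + \<tau> * (l' x - l x) + \<gamma> * (\<integral>s'. val l' s' - val l s' \<partial>P x)
      = (Q (val l') x + \<tau> * l' x) - val l (fst x)" for x
  proof -
    have Px: "P x \<in> Prob" by (rule Prob_kernel[OF P]) simp
    show ?thesis
      by (simp add: adv_def Q_real_def Prob_integral_diff[OF Px val_Bb[OF l'] val_Bb[OF l]] algebra_simps)
  qed
  have "avg l' (\<lambda>x. adv l x + \<tau> * (l' x - l x)) s
      + avg l' (\<lambda>x. \<gamma> * (\<integral>s'. val l' s' - val l s' \<partial>P x)) s
    = avg l' (\<lambda>x. (Q (val l') x + \<tau> * l' x) - val l (fst x)) s"
    unfolding eq[symmetric]
    by (rule avg_add[OF l', symmetric]) (intro B adv_Bb Bb_integral_kernel'[OF P D])+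
  also have "\<dots> = val l' s - val l s"
    unfolding val_eq[OF l', of s]
    by (subst avg_diff[OF l']) (intro B, intro B, simp add: avg_state[OF l'])
  finally show ?thesis
    by (simp add: integral_P_pol[OF l' D] avg_cmult[OF l'])
qed

lemma integral_adv_occ_init:
  assumes l: "l \<in> log_densities" and l': "l' \<in> log_densities" and \<rho>: "\<rho> \<in> Prob"
  shows "(\<integral>s. avg l' (\<lambda>x. adv l x + \<tau> * (l' x - l x)) s \<partial>occ_init P \<gamma> (pol l') \<rho>)
    = (1 - \<gamma>) * (\<integral>s. val l' s - val l s \<partial>\<rho>)"
  by (rule integral_occ_init[OF P pol_kernel[OF l'] \<gamma> \<rho> _ _ val_difference[OF l l']])
     (intro avg_Bb[OF l'] Bb_add Bb_diff Bb_cmult adv_Bb val_Bb l l' log_densitiesD(1))+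

section \<open>The mirror step, its improvement and its optimality\<close>

definition tilt :: "real \<Rightarrow> ('s \<times> 'a \<Rightarrow> real) \<Rightarrow> 's \<times> 'a \<Rightarrow> real" where
  "tilt \<eta> l x = l x - (1 / \<eta>) * adv l x"

definition mirror_step :: "real \<Rightarrow> ('s \<times> 'a \<Rightarrow> real) \<Rightarrow> 's \<times> 'a \<Rightarrow> real" where
  "mirror_step \<eta> l x = tilt \<eta> l x - log_mean (tilt \<eta> l) (fst x)"

text \<open>For \<open>\<eta> > 0\<close> this is the mirror objective at the mirror step: the
  relative entropy in \<open>mirror_objective_pol\<close> vanishes there.\<close>

definition gain :: "real \<Rightarrow> ('s \<times> 'a \<Rightarrow> real) \<Rightarrow> 's \<Rightarrow> real" where
  "gain \<eta> l s = - \<eta> * log_mean (tilt \<eta> l) s"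

lemma tilt_Bb: "l \<in> log_densities \<Longrightarrow> tilt \<eta> l \<in> Bb"
  unfolding tilt_def by (intro Bb_diff Bb_cmult adv_Bb log_densitiesD(1))

lemma mirror_step_log_density: "l \<in> log_densities \<Longrightarrow> mirror_step \<eta> l \<in> log_densities"
  using normalise_log_density[OF tilt_Bb[of l \<eta>]] unfolding mirror_step_def[abs_def] .

lemma gain_Bb: "l \<in> log_densities \<Longrightarrow> gain \<eta> l \<in> Bb"
  unfolding gain_def[abs_def] by (intro Bb_cmult log_mean_Bb tilt_Bb)

text \<open>The definition of the mirror step solved for the advantage. Up to a function of the
  state it is a difference of log-densities, so its averages become relative entropies.\<close>

lemma adv_eq: "0 < \<eta> \<Longrightarrow> adv l x = gain \<eta> l (fst x) + \<eta> * (l x - mirror_step \<eta> l x)"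
  by (simp add: gain_def mirror_step_def tilt_def algebra_simps)

text \<open>The advantage averages to 0 under its own policy, so \<open>adv_eq\<close> gives
  \<open>gain\<close> as \<open>-\<eta>\<close> times a relative entropy.\<close>

lemma gain_nonpos:
  assumes l: "l \<in> log_densities" and \<eta>: "0 < \<eta>"
  shows "gain \<eta> l s \<le> 0"
proof -
  note B = Bb_add Bb_diff Bb_cmult Bb_fst gain_Bb[OF l] mirror_step_log_density[OF l] l log_densitiesD(1)
  have "avg l (adv l) s = gain \<eta> l s + \<eta> * avg l (\<lambda>x. l x - mirror_step \<eta> l x) s"
    unfolding adv_eq[OF \<eta>, of l, abs_def]
    by (subst avg_add[OF l]) (intro B, intro B, simp add: avg_state[OF l] avg_cmult[OF l])
  then show ?thesis
    using avg_log_ratio_nonneg[OF l mirror_step_log_density[OF l, of \<eta>], of s] \<eta> avg_adv[OF l, of s]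
    by (smt (verit) mult_nonneg_nonneg)
qed

text \<open>By \<open>adv_eq\<close> the source \<open>?h\<close> in the performance difference is
  \<open>gain\<close> minus \<open>\<eta> - \<tau>\<close> times a relative entropy, hence at most
  \<open>gain\<close>; this is where \<open>\<tau> \<le> \<eta>\<close> enters.\<close>

lemma val_mirror_step:
  assumes l: "l \<in> log_densities" and \<eta>: "0 < \<eta>" "\<tau> \<le> \<eta>"
  shows "val (mirror_step \<eta> l) s - val l s \<le> gain \<eta> l s" "val (mirror_step \<eta> l) s \<le> val l s"
proof -
  let ?l' = "mirror_step \<eta> l"
  have l': "?l' \<in> log_densities" by (rule mirror_step_log_density[OF l])
  note B = Bb_add Bb_diff Bb_cmult Bb_fst gain_Bb[OF l] adv_Bb[OF l] val_Bb l l' log_densitiesD(1)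
  let ?D = "\<lambda>s. val ?l' s - val l s"
  let ?h = "avg ?l' (\<lambda>x. adv l x + \<tau> * (?l' x - l x))"
  have h: "?h s \<le> gain \<eta> l s" for s
  proof -
    have "adv l x + \<tau> * (?l' x - l x) = gain \<eta> l (fst x) - (\<eta> - \<tau>) * (?l' x - l x)" for x
      by (simp add: adv_eq[OF \<eta>(1)] algebra_simps)
    then have "?h s = avg ?l' (\<lambda>x. gain \<eta> l (fst x) - (\<eta> - \<tau>) * (?l' x - l x)) s" by simp
    also have "\<dots> = gain \<eta> l s - (\<eta> - \<tau>) * avg ?l' (\<lambda>x. ?l' x - l x) s"
      by (subst avg_diff[OF l']) (intro B, intro B, simp add: avg_state[OF l'] avg_cmult[OF l'])
    finally show ?thesis using avg_log_ratio_nonneg[OF l' l, of s] \<eta> by simp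
  qed
  have hB: "?h \<in> Bb" and DB: "?D \<in> Bb" by (intro avg_Bb[OF l'] B)+
  \<comment> \<open>\<open>?D\<close> is an occupancy average of the nonpositive \<open>?h\<close>
    divided by \<open>1 - \<gamma>\<close>.\<close>
  have D: "?D s \<le> 0" for s
  proof -
    note K = P pol_kernel[OF l']
    have o: "occ P \<gamma> (pol ?l') s \<in> Prob" by (rule Prob_kernel[OF occ_kernel[OF K \<gamma>]]) simp
    have h0: "?h s \<le> 0" for s by (rule order.trans[OF h gain_nonpos[OF l \<eta>(1)]])
    have "(\<integral>s'. ?h s' \<partial>occ P \<gamma> (pol ?l') s) \<le> (\<integral>s'. 0 \<partial>occ P \<gamma> (pol ?l') s)"
      by (rule Prob_integral_mono[OF o hB Bb_const h0])
    then have "(1 - \<gamma>) * ?D s \<le> 0"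
      using integral_occ[OF K \<gamma> hB DB val_difference[OF l l']] by simp
    then show ?thesis using \<gamma> by (simp add: mult_le_0_iff)
  qed
  from D[of s] show "val ?l' s \<le> val l s" by simp
  have p: "P_pol P (pol ?l') s \<in> Prob" by (rule Prob_kernel[OF P_pol_kernel[OF P pol_kernel[OF l']]]) simp
  \<comment> \<open>With future differences nonpositive, the one-step identity sharpens to
    \<open>?D s \<le> ?h s\<close>.\<close>
  have "(\<integral>s'. ?D s' \<partial>P_pol P (pol ?l') s) \<le> (\<integral>s'. 0 \<partial>P_pol P (pol ?l') s)"
    by (rule Prob_integral_mono[OF p DB Bb_const D])
  then have "\<gamma> * (\<integral>s'. ?D s' \<partial>P_pol P (pol ?l') s) \<le> 0"
    using \<gamma> by (simp add: mult_nonneg_nonpos)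
  then show "?D s \<le> gain \<eta> l s" using val_difference[OF l l', of s] h[of s] by linarith
qed

text \<open>\<open>adv_eq\<close> inserted into the performance difference with a free comparison
  policy \<open>l'\<close>: its relative entropies from the new and the old iterate appear with
  weights \<open>\<eta>\<close> and \<open>\<eta> - \<tau>\<close>.\<close>

lemma three_point_occ_init:
  assumes l: "l \<in> log_densities" and l': "l' \<in> log_densities" and \<rho>: "\<rho> \<in> Prob" and \<eta>: "0 < \<eta>"
  defines "d \<equiv> occ_init P \<gamma> (pol l') \<rho>"
  shows "(1 - \<gamma>) * (\<integral>s. val l' s - val l s \<partial>\<rho>) = (\<integral>s. gain \<eta> l s \<partial>d)
    + \<eta> * (\<integral>s. avg l' (\<lambda>x. l' x - mirror_step \<eta> l x) s \<partial>d) - (\<eta> - \<tau>) * (\<integral>s. avg l' (\<lambda>x. l' x - l x) s \<partial>d)"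
proof -
  let ?n = "mirror_step \<eta> l"
  have n: "?n \<in> log_densities" by (rule mirror_step_log_density[OF l])
  note B = Bb_add Bb_diff Bb_cmult Bb_fst gain_Bb[OF l] avg_Bb[OF l'] l l' n log_densitiesD(1)
  have d: "d \<in> Prob" unfolding d_def by (rule occ_init_Prob[OF P pol_kernel[OF l'] \<gamma> \<rho>])
  have "avg l' (\<lambda>x. adv l x + \<tau> * (l' x - l x)) s
    = gain \<eta> l s + \<eta> * avg l' (\<lambda>x. l' x - ?n x) s - (\<eta> - \<tau>) * avg l' (\<lambda>x. l' x - l x) s" for s
  proof -
    have "adv l x + \<tau> * (l' x - l x)
        = (gain \<eta> l (fst x) + \<eta> * (l' x - ?n x)) - (\<eta> - \<tau>) * (l' x - l x)" for x
      by (simp add: adv_eq[OF \<eta>] algebra_simps)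
    then have "avg l' (\<lambda>x. adv l x + \<tau> * (l' x - l x)) s
      = avg l' (\<lambda>x. (gain \<eta> l (fst x) + \<eta> * (l' x - ?n x)) - (\<eta> - \<tau>) * (l' x - l x)) s" by simp
    also have "\<dots> = avg l' (\<lambda>x. gain \<eta> l (fst x) + \<eta> * (l' x - ?n x)) s
        - avg l' (\<lambda>x. (\<eta> - \<tau>) * (l' x - l x)) s"
      by (rule avg_diff[OF l']) (intro B)+
    also have "avg l' (\<lambda>x. gain \<eta> l (fst x) + \<eta> * (l' x - ?n x)) s
        = avg l' (\<lambda>x. gain \<eta> l (fst x)) s + avg l' (\<lambda>x. \<eta> * (l' x - ?n x)) s"
      by (rule avg_add[OF l']) (intro B)+
    finally show ?thesis by (simp add: avg_state[OF l'] avg_cmult[OF l'])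
  qed
  then have "(1 - \<gamma>) * (\<integral>s. val l' s - val l s \<partial>\<rho>)
    = (\<integral>s. (gain \<eta> l s + \<eta> * avg l' (\<lambda>x. l' x - ?n x) s) - (\<eta> - \<tau>) * avg l' (\<lambda>x. l' x - l x) s \<partial>d)"
    using integral_adv_occ_init[OF l l' \<rho>] by (simp add: d_def)
  also have "\<dots> = (\<integral>s. gain \<eta> l s + \<eta> * avg l' (\<lambda>x. l' x - ?n x) s \<partial>d)
      - (\<integral>s. (\<eta> - \<tau>) * avg l' (\<lambda>x. l' x - l x) s \<partial>d)"
    by (rule Prob_integral_diff[OF d]) (intro B)+
  also have "(\<integral>s. gain \<eta> l s + \<eta> * avg l' (\<lambda>x. l' x - ?n x) s \<partial>d)
      = (\<integral>s. gain \<eta> l s \<partial>d) + (\<integral>s. \<eta> * avg l' (\<lambda>x. l' x - ?n x) s \<partial>d)"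
    by (rule Prob_integral_add[OF d]) (intro B)+
  finally show ?thesis by simp
qed

text \<open>Equality case of the Gibbs inequality. With \<open>u = l - l'\<close>, the function
  \<open>u - 1 + exp (- u)\<close> is nonnegative and integrates to the relative entropy, which is
  0; so it vanishes almost everywhere, which forces \<open>u = 0\<close> there. The log-densities
  themselves may differ on a null set.\<close>

lemma pol_eqI:
  assumes l: "l \<in> log_densities" and l': "l' \<in> log_densities" and 0: "avg l (\<lambda>x. l x - l' x) s \<le> 0"
  shows "pol l s = pol l' s"
proof -
  note B = Bb_add Bb_diff Bb_exp Bb_const Bb_Pair l l' log_densitiesD(1)
  let ?u = "\<lambda>a. l (s, a) - l' (s, a)"
  let ?p = "\<lambda>a. ?u a - 1 + exp (- ?u a)"
  have m: "pol l s \<in> Prob" by (rule pol_Prob[OF l])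
  have uB: "?u \<in> Bb" by (intro B)
  have eB: "(\<lambda>a. exp (- ?u a)) \<in> Bb" using Bb_exp[OF Bb_cmult[OF uB, of "-1"]] by simp
  have e1: "(\<integral>a. exp (- ?u a) \<partial>pol l s) = 1"
  proof -
    have "(\<integral>a. exp (- ?u a) \<partial>pol l s) = (\<integral>a. exp (l (s, a)) * exp (- ?u a) \<partial>\<mu>)"
      unfolding pol_def by (rule integral_exp_density[OF \<mu> _ eB]) (intro B)
    then show ?thesis by (simp add: exp_add[symmetric] log_densitiesD(2)[OF l'])
  qed
  have "(\<integral>a. ?p a \<partial>pol l s) = avg l (\<lambda>x. l x - l' x) s - 1 + 1"
    unfolding avg_def
    by (subst Prob_integral_add[OF m _ eB], intro Bb_diff Bb_const uB,
        subst Prob_integral_diff[OF m uB Bb_const], simp only: e1 Prob_integral_const[OF m])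
  with 0 avg_log_ratio_nonneg[OF l l', of s] have "(\<integral>a. ?p a \<partial>pol l s) = 0" by simp
  moreover have "0 \<le> ?p a" for a using exp_ge_add_one_self[of "- ?u a"] by linarith
  moreover have "integrable (pol l s) ?p" by (rule Prob_integrable[OF m]) (intro Bb_add Bb_diff Bb_const uB eB)
  ultimately have "AE a in pol l s. ?p a = 0"
    by (subst (asm) integral_nonneg_eq_0_iff_AE) auto
  then have "AE a in \<mu>. ?p a = 0"
    unfolding pol_def by (subst (asm) AE_exp_density_iff[OF \<mu>]) (intro B)
  then have AE: "AE a in \<mu>. ennreal (exp (l (s, a))) = ennreal (exp (l' (s, a)))"
  proof eventually_elim
    fix a assume "?p a = 0"
    then have "ln (exp (- ?u a)) = exp (- ?u a) - 1" by simp
    then have "exp (- ?u a) = 1" by (intro ln_eq_minus_one) auto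
    then show "ennreal (exp (l (s, a))) = ennreal (exp (l' (s, a)))" by simp
  qed
  have [measurable]: "(\<lambda>a. l (s, a)) \<in> borel_measurable \<mu>" "(\<lambda>a. l' (s, a)) \<in> borel_measurable \<mu>"
    using Bb_measurable[OF Bb_Pair[OF log_densitiesD(1)[OF l]]] Bb_measurable[OF Bb_Pair[OF log_densitiesD(1)[OF l']]]
      ProbD(1)[OF \<mu>] by (simp_all cong: measurable_cong_sets)
  show ?thesis unfolding pol_def exp_density_def by (rule density_cong[OF _ _ AE]) auto
qed

text \<open>By \<open>adv_eq\<close> the linear term and the relative entropy from the old policy
  combine into a relative entropy from the mirror step, plus a constant independent of
  \<open>l'\<close>.\<close>

lemma mirror_objective_pol:
  assumes l: "l \<in> log_densities" and l': "l' \<in> log_densities" and \<eta>: "0 < \<eta>"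
  shows "mirror_objective P c \<gamma> \<mu> \<tau> \<eta> (pol l) s (pol l' s)
    = ereal (gain \<eta> l s + \<eta> * avg l' (\<lambda>x. l' x - mirror_step \<eta> l x) s)"
proof -
  let ?n = "mirror_step \<eta> l"
  have n: "?n \<in> log_densities" by (rule mirror_step_log_density[OF l])
  note B = Bb_add Bb_diff Bb_cmult Bb_fst gain_Bb[OF l] adv_Bb[OF l] l l' n log_densitiesD(1)
  \<comment> \<open>\<open>dV\<close> uses the version of the density picked by
    \<open>RN_deriv\<close>, so it equals \<open>adv\<close> only almost everywhere; equivalence
    with \<open>\<mu>\<close> carries this to every \<open>pol k s\<close>.\<close>
  have "AE a in \<mu>. dV P c \<gamma> \<mu> \<tau> (pol l) s a = ereal (adv l (s, a))"
    using RN_deriv_exp_density[OF \<mu> Bb_Pair[OF log_densitiesD(1)[OF l]], of s]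
    by eventually_elim
       (simp add: dV_def V_stat_val[OF l] bellman_Q_real[OF val_Bb[OF l]] adv_def pol_def)
  then have AE: "AE a in pol k s. dV P c \<gamma> \<mu> \<tau> (pol l) s a = ereal (adv l (s, a))"
    if "k \<in> log_densities" for k
    unfolding pol_def[of k] by (subst AE_exp_density_iff[OF \<mu> Bb_Pair[OF log_densitiesD(1)[OF that]]])
  have eint: "eintegral (pol k s) (dV P c \<gamma> \<mu> \<tau> (pol l) s) = ereal (avg k (adv l) s)"
    if "k \<in> log_densities" for k
    unfolding eintegral_cong_AE[OF AE[OF that]] avg_def
    by (rule Prob_eintegral[OF pol_Prob[OF that] Bb_Pair[OF adv_Bb[OF l]]])
  have "avg l' (adv l) s + \<eta> * avg l' (\<lambda>x. l' x - l x) s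
      = avg l' (\<lambda>x. adv l x + \<eta> * (l' x - l x)) s"
    unfolding avg_cmult[OF l', symmetric] by (rule avg_add[OF l', symmetric]) (intro B)+
  also have "(\<lambda>x. adv l x + \<eta> * (l' x - l x)) = (\<lambda>x. gain \<eta> l (fst x) + \<eta> * (l' x - ?n x))"
    by (simp add: adv_eq[OF \<eta>] fun_eq_iff algebra_simps)
  also have "avg l' \<dots> s = gain \<eta> l s + \<eta> * avg l' (\<lambda>x. l' x - ?n x) s"
    by (subst avg_add[OF l']) (intro B, intro B, simp add: avg_state[OF l'] avg_cmult[OF l'])
  finally show ?thesis
    unfolding mirror_objective_def eint[OF l] eint[OF l'] KL_pol[OF l' l] avg_adv[OF l] by simp
qed

text \<open>Testing minimality against the mirror step bounds the relative entropy of the minimiser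
  from it by 0, and \<open>pol_eqI\<close> applies.\<close>

lemma mirror_argmin:
  assumes l: "l \<in> log_densities" and l': "l' \<in> log_densities" and \<eta>: "0 < \<eta>"
    and min: "is_arg_min (mirror_objective P c \<gamma> \<mu> \<tau> \<eta> (pol l) s) (\<lambda>m. m \<in> Prob) (pol l' s)"
  shows "pol l' s = pol (mirror_step \<eta> l) s"
proof (rule pol_eqI[OF l'])
  let ?n = "mirror_step \<eta> l"
  show n: "?n \<in> log_densities" by (rule mirror_step_log_density[OF l])
  have "\<not> mirror_objective P c \<gamma> \<mu> \<tau> \<eta> (pol l) s (pol ?n s)
      < mirror_objective P c \<gamma> \<mu> \<tau> \<eta> (pol l) s (pol l' s)"
    using min pol_Prob[OF n] by (auto simp: is_arg_min_def)
  moreover have "avg ?n (\<lambda>x. ?n x - ?n x) s = 0" by (simp add: avg_def)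
  ultimately have "\<eta> * avg l' (\<lambda>x. l' x - ?n x) s \<le> 0"
    unfolding mirror_objective_pol[OF l n \<eta>] mirror_objective_pol[OF l l' \<eta>] by simp
  then show "avg l' (\<lambda>x. l' x - ?n x) s \<le> 0" using \<eta> by (simp add: mult_le_0_iff)
qed

lemma Pi_mu_log_density:
  assumes "\<pi> \<in> Pi_mu \<mu>" obtains l where "l \<in> log_densities" "\<pi> = pol l"
  using assms gibbs_eq_pol normalise_log_density unfolding Pi_mu_def by blast

text \<open>Log-densities of the given policies are determined only up to null sets. Iterating
  \<open>mirror_step\<close> from one for \<open>\<pi> 0\<close> fixes versions that satisfy the
  recursion exactly.\<close>

lemma mirror_descent_log_densities:
  assumes \<eta>: "0 < \<eta>" and \<pi>: "\<And>n. \<pi> n \<in> Pi_mu \<mu>"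
    and mirror: "\<And>n s. is_arg_min (mirror_objective P c \<gamma> \<mu> \<tau> \<eta> (\<pi> n) s) (\<lambda>m. m \<in> Prob) (\<pi> (Suc n) s)"
  obtains L where "\<And>n. L n \<in> log_densities" "\<And>n. \<pi> n = pol (L n)" "\<And>n. L (Suc n) = mirror_step \<eta> (L n)"
proof -
  obtain l0 where l0: "l0 \<in> log_densities" "\<pi> 0 = pol l0" by (rule Pi_mu_log_density[OF \<pi>])
  define L where "L n = (mirror_step \<eta> ^^ n) l0" for n
  have S: "L (Suc n) = mirror_step \<eta> (L n)" for n by (simp add: L_def)
  have L: "L n \<in> log_densities" for n
    by (induction n) (auto simp: S mirror_step_log_density, simp add: L_def l0)
  have "\<pi> n = pol (L n)" for n
  proof (induction n)
    case 0 then show ?case by (simp add: L_def l0)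
  next
    case (Suc n)
    obtain l' where l': "l' \<in> log_densities" "\<pi> (Suc n) = pol l'" by (rule Pi_mu_log_density[OF \<pi>])
    have "\<pi> (Suc n) s = pol (L (Suc n)) s" for s
      unfolding S l'(2) by (rule mirror_argmin[OF L l'(1) \<eta>]) (use mirror[of n s] Suc l' in simp)
    then show ?case by auto
  qed
  from that[OF L this S] show thesis .
qed

end

subsection \<open>Convergence\<close>

lemma sup_norm_ge: "f \<in> Bb \<Longrightarrow> \<bar>f x\<bar> \<le> sup_norm f"
  unfolding sup_norm_def
  by (rule cSUP_upper) (auto simp: Bb_iff bdd_above_def)

locale mirror_descent = entropy_mdp P c \<gamma> \<tau> \<mu>
  for P :: "'s::polish_space \<times> 'a::polish_space \<Rightarrow> 's measure" and c \<gamma> \<tau> \<mu> +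
  fixes \<eta> :: real and L :: "nat \<Rightarrow> 's \<times> 'a \<Rightarrow> real" and w :: "'s \<Rightarrow> real" and \<rho> :: "'s measure"
  assumes \<eta>: "0 < \<eta>" "\<tau> \<le> \<eta>"
    and L: "\<And>n. L n \<in> log_densities" and L_Suc: "\<And>n. L (Suc n) = mirror_step \<eta> (L n)"
    and w: "w \<in> Bb" "V_opt P c \<gamma> \<mu> \<tau> = (\<lambda>s. ereal (w s))" and opt: "l_opt w \<in> log_densities"
    and val_opt: "val (l_opt w) = w" and \<rho>: "\<rho> \<in> Prob"
begin

definition "occ_opt = occ_init P \<gamma> (pol (l_opt w)) \<rho>"
definition "gap n = (\<integral>s. val (L n) s \<partial>\<rho>) - (\<integral>s. w s \<partial>\<rho>)"
text \<open>By \<open>KL_pol\<close> the integrand is the relative entropy of the optimal policy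
  from the n-th iterate.\<close>

definition "divg n = (\<integral>s. avg (l_opt w) (\<lambda>x. l_opt w x - L n x) s \<partial>occ_opt)"
definition "gains n = (\<integral>s. gain \<eta> (L n) s \<partial>occ_opt)"

lemma occ_opt_Prob: "occ_opt \<in> Prob"
  unfolding occ_opt_def by (rule occ_init_Prob[OF P pol_kernel[OF opt] \<gamma> \<rho>])

lemma w_le_val: "w s \<le> val (L n) s"
proof -
  have "V_opt P c \<gamma> \<mu> \<tau> s \<le> V_stat P c \<gamma> \<mu> \<tau> (pol (L n)) s"
    unfolding V_opt_def by (rule INF_lower[OF stationary_policies[OF L]])
  then show ?thesis by (simp add: w(2) V_stat_val[OF L])
qed

lemma gap_nonneg: "0 \<le> gap n"
  unfolding gap_def using Prob_integral_mono[OF \<rho> w(1) val_Bb[OF L] w_le_val] by simp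

lemma gap_Suc: "gap (Suc n) \<le> gap n"
  unfolding gap_def
  using Prob_integral_mono[OF \<rho> val_Bb[OF L[of "Suc n"]] val_Bb[OF L[of n]]] val_mirror_step(2)[OF L \<eta>]
  by (simp add: L_Suc)

lemma divg_nonneg: "0 \<le> divg n"
proof -
  have "(\<integral>s. 0 \<partial>occ_opt) \<le> divg n"
    unfolding divg_def
    by (intro Prob_integral_mono[OF occ_opt_Prob] Bb_const avg_Bb[OF opt] Bb_diff log_densitiesD(1) opt L
        avg_log_ratio_nonneg)
  then show ?thesis by simp
qed

text \<open>The three-point identity with the optimal policy as comparison; signs are reversed
  because \<open>gap\<close> is the iterate's value minus the optimal one.\<close>

lemma gap_eq: "(1 - \<gamma>) * gap n = (\<eta> - \<tau>) * divg n - \<eta> * divg (Suc n) - gains n"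
  using three_point_occ_init[OF L opt \<rho> \<eta>(1), of n]
  by (simp add: val_opt Prob_integral_diff[OF \<rho> w(1) val_Bb[OF L]] gap_def divg_def gains_def occ_opt_def
      L_Suc algebra_simps)

lemma gains_ge:
  "(\<integral>s. val (L (Suc n)) s \<partial>occ_opt) - (\<integral>s. val (L n) s \<partial>occ_opt) \<le> gains n"
  unfolding gains_def Prob_integral_diff[OF occ_opt_Prob val_Bb[OF L] val_Bb[OF L], symmetric]
  by (intro Prob_integral_mono[OF occ_opt_Prob] Bb_diff val_Bb gain_Bb L)
     (simp only: L_Suc val_mirror_step(1)[OF L \<eta>])

text \<open>Enlarging \<open>\<eta> - \<tau>\<close> to \<open>\<eta>\<close> makes values and
  relative entropies both telescope. The sum of the gaps is thus bounded, and by monotonicity it is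
  at least \<open>N\<close> times the last gap.\<close>

lemma sublinear_rate:
  assumes "1 \<le> N"
  shows "gap N \<le> 1 / (1 - \<gamma>) * (\<eta> * divg 0 + (\<integral>s. val (L 0) s - w s \<partial>occ_opt)) * (1 / real N)"
proof -
  let ?u = "\<lambda>n. \<integral>s. val (L n) s \<partial>occ_opt"
  have step: "(1 - \<gamma>) * gap n \<le> ?u n - ?u (Suc n) + \<eta> * divg n - \<eta> * divg (Suc n)" for n
  proof -
    have "(\<eta> - \<tau>) * divg n \<le> \<eta> * divg n"
      using \<tau> divg_nonneg[of n] by (intro mult_right_mono) auto
    then show ?thesis using gap_eq[of n] gains_ge[of n] by linarith
  qed
  have "(1 - \<gamma>) * (\<Sum>n<k. gap n) \<le> ?u 0 - ?u k + \<eta> * divg 0 - \<eta> * divg k" for k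
  proof (induction k)
    case (Suc k) then show ?case using step[of k] by (simp add: algebra_simps)
  qed simp
  moreover have "real N * gap N \<le> (\<Sum>n<N. gap n)"
  proof -
    have "gap N \<le> gap n" if "n < N" for n
      using that by (intro lift_Suc_antimono_le[of gap, OF gap_Suc]) auto
    then have "(\<Sum>n<N. gap N) \<le> (\<Sum>n<N. gap n)" by (intro sum_mono) auto
    then show ?thesis by simp
  qed
  moreover have "(\<integral>s. w s \<partial>occ_opt) \<le> ?u N"
    by (rule Prob_integral_mono[OF occ_opt_Prob w(1) val_Bb[OF L] w_le_val])
  moreover have "0 \<le> \<eta> * divg N" using \<eta> divg_nonneg by simp
  ultimately have "(1 - \<gamma>) * (real N * gap N) \<le> \<eta> * divg 0 + (?u 0 - (\<integral>s. w s \<partial>occ_opt))"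
    using \<gamma> by (smt (verit) mult_left_mono)
  then show ?thesis
    using \<gamma> assms unfolding Prob_integral_diff[OF occ_opt_Prob val_Bb[OF L] w(1)]
    by (simp add: field_simps)
qed

text \<open>Since \<open>gain\<close> is nonpositive, the density bound transfers it from
  \<open>occ_opt\<close> to \<open>\<rho>\<close>, where it dominates the decrease of the gap. The
  condition \<open>\<eta> \<le> \<xi> * \<tau>\<close> gives the entropy term the same contraction
  factor as the gap.\<close>

lemma linear_rate:
  assumes D: "D \<in> Bb" "\<And>s. 0 \<le> D s" and dens: "occ_opt = density \<rho> (\<lambda>s. ennreal (D s))"
    and \<xi>: "\<xi> = inverse (1 - \<gamma>) * sup_norm D" and \<eta>\<xi>: "\<eta> \<le> \<xi> * \<tau>"
  shows "gap n + \<eta> / ((1 - \<gamma>) * \<xi>) * divg n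
    \<le> ((\<xi> - 1) / \<xi>) ^ n * (gap 0 + \<eta> / ((1 - \<gamma>) * \<xi>) * divg 0)"
proof (induction n)
  case (Suc n)
  have M: "(1 - \<gamma>) * \<xi> = sup_norm D" using \<xi> \<gamma> by simp
  \<comment> \<open>The chain \<open>\<tau> \<le> \<eta> \<le> \<xi> * \<tau>\<close> forces
    \<open>\<xi> \<ge> 1\<close>, so the contraction factor is nonnegative and divisions by
    \<open>\<xi>\<close> are safe.\<close>
  have "1 * \<tau> \<le> \<xi> * \<tau>" using \<eta> \<eta>\<xi> by simp
  then have \<xi>1: "1 \<le> \<xi>" using \<tau> by simp
  then have M0: "0 < (1 - \<gamma>) * \<xi>" using \<gamma> by simp
  have gains: "(1 - \<gamma>) * \<xi> * (gap (Suc n) - gap n) \<le> gains n"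
  proof -
    have gB: "gain \<eta> (L n) \<in> Bb" by (rule gain_Bb[OF L])
    have DB: "(\<lambda>s. val (L (Suc n)) s - val (L n) s) \<in> Bb" by (intro Bb_diff val_Bb L)
    have [measurable]: "D \<in> borel_measurable \<rho>" "gain \<eta> (L n) \<in> borel_measurable \<rho>"
      using Bb_measurable[OF D(1)] Bb_measurable[OF gB] ProbD(1)[OF \<rho>] by (simp_all cong: measurable_cong_sets)
    have "(1 - \<gamma>) * \<xi> * (gap (Suc n) - gap n) = (\<integral>s. sup_norm D * (val (L (Suc n)) s - val (L n) s) \<partial>\<rho>)"
      by (simp add: M gap_def Prob_integral_diff[OF \<rho> val_Bb[OF L] val_Bb[OF L]])
    also have "\<dots> \<le> (\<integral>s. D s * gain \<eta> (L n) s \<partial>\<rho>)"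
    proof (intro Prob_integral_mono[OF \<rho>] Bb_cmult Bb_mult DB gB D)
      fix s
      have "sup_norm D * (val (L (Suc n)) s - val (L n) s) \<le> sup_norm D * gain \<eta> (L n) s"
        using val_mirror_step(1)[OF L \<eta>, of n s] M M0 by (intro mult_left_mono) (simp_all add: L_Suc)
      \<comment> \<open>Replacing \<open>sup_norm D\<close> by the smaller \<open>D s\<close>
        increases the product because \<open>gain\<close> is nonpositive.\<close>
      also have "\<dots> \<le> D s * gain \<eta> (L n) s"
        using sup_norm_ge[OF D(1), of s] gain_nonpos[OF L \<eta>(1), of n s] by (intro mult_right_mono_neg) auto
      finally show "sup_norm D * (val (L (Suc n)) s - val (L n) s) \<le> D s * gain \<eta> (L n) s" .
    qed
    also have "\<dots> = gains n"
      unfolding gains_def dens using D(2) by (subst integral_density) auto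
    finally show ?thesis .
  qed
  \<comment> \<open>After cancelling \<open>\<eta>\<close> this is
    \<open>\<eta> / \<xi> \<le> \<tau>\<close>, the upper bound on the step parameter.\<close>
  have "(\<eta> - \<tau>) * divg n \<le> \<eta> * ((\<xi> - 1) / \<xi>) * divg n"
  proof (intro mult_right_mono divg_nonneg)
    show "\<eta> - \<tau> \<le> \<eta> * ((\<xi> - 1) / \<xi>)" using \<xi>1 \<eta>\<xi> by (simp add: field_simps)
  qed
  with gap_eq[of n] gains
  have main: "(1 - \<gamma>) * \<xi> * gap (Suc n) + \<eta> * divg (Suc n)
      \<le> (1 - \<gamma>) * \<xi> * gap n - (1 - \<gamma>) * gap n + \<eta> * ((\<xi> - 1) / \<xi>) * divg n"
    by (simp add: right_diff_distrib)
  \<comment> \<open>The two gap terms combine to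
    \<open>(1 - \<gamma>) * (\<xi> - 1) * gap n\<close>, so the factor comes out of both
    summands.\<close>
  also have "\<dots> = ((\<xi> - 1) / \<xi>) * ((1 - \<gamma>) * \<xi> * gap n + \<eta> * divg n)"
    using \<xi>1 by (simp add: field_simps)
  finally have "((1 - \<gamma>) * \<xi> * gap (Suc n) + \<eta> * divg (Suc n)) / ((1 - \<gamma>) * \<xi>)
      \<le> ((\<xi> - 1) / \<xi>) * ((1 - \<gamma>) * \<xi> * gap n + \<eta> * divg n) / ((1 - \<gamma>) * \<xi>)"
    using M0 by (intro divide_right_mono) auto
  moreover have "((1 - \<gamma>) * \<xi> * g + \<eta> * k) / ((1 - \<gamma>) * \<xi>) = g + \<eta> / ((1 - \<gamma>) * \<xi>) * k" for g k
    unfolding add_divide_distrib nonzero_mult_div_cancel_left[OF less_imp_neq[OF M0, symmetric]] by simp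
  ultimately have "gap (Suc n) + \<eta> / ((1 - \<gamma>) * \<xi>) * divg (Suc n)
      \<le> ((\<xi> - 1) / \<xi>) * (gap n + \<eta> / ((1 - \<gamma>) * \<xi>) * divg n)"
    by (simp only: times_divide_eq_right[symmetric])
  also have "\<dots> \<le> ((\<xi> - 1) / \<xi>) * (((\<xi> - 1) / \<xi>) ^ n * (gap 0 + \<eta> / ((1 - \<gamma>) * \<xi>) * divg 0))"
    using \<xi>1 by (intro mult_left_mono Suc) auto
  finally show ?case by (simp only: power_Suc mult.assoc)
qed simp

section \<open>Return from the real sequences to the extended-valued integrals\<close>

lemma eintegral_gap:
  "eintegral \<rho> (V_stat P c \<gamma> \<mu> \<tau> (pol (L n))) - eintegral \<rho> (V_opt P c \<gamma> \<mu> \<tau>) = ereal (gap n)"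
  by (simp add: V_stat_val[OF L] w(2) Prob_eintegral[OF \<rho>] val_Bb[OF L] w(1) gap_def)

lemma eintegral_divg:
  "eintegral occ_opt (\<lambda>s. KL (pol (l_opt w) s) (pol (L n) s)) = ereal (divg n)"
  unfolding KL_pol[OF opt L] divg_def
  by (intro Prob_eintegral[OF occ_opt_Prob] avg_Bb[OF opt] Bb_diff log_densitiesD(1) opt L)

lemma eintegral_initial_gap:
  "eintegral occ_opt (\<lambda>s. V_stat P c \<gamma> \<mu> \<tau> (pol (L n)) s - V_opt P c \<gamma> \<mu> \<tau> s)
    = ereal (\<integral>s. val (L n) s - w s \<partial>occ_opt)"
  using Prob_eintegral[OF occ_opt_Prob Bb_diff[OF val_Bb[OF L] w(1)]]
  by (simp add: V_stat_val[OF L] w(2))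

end

theorem theorem2p14:
  fixes P :: "'s::polish_space \<times> 'a::polish_space \<Rightarrow> 's measure"
    and c :: "'s \<times> 'a \<Rightarrow> real"
    and \<gamma> \<tau> \<eta> :: real
    and \<mu> :: "'a measure"
    and \<pi> :: "nat \<Rightarrow> 's \<Rightarrow> 'a measure"
  assumes P: "P \<in> borel \<rightarrow>\<^sub>M prob_algebra borel"
    and c: "c \<in> Bb"
    and \<gamma>: "0 \<le> \<gamma>" "\<gamma> < 1"
    and \<mu>: "\<mu> \<in> Prob"
    and \<tau>: "0 < \<tau>"
    and \<eta>: "0 < \<eta>"
    and \<pi>: "\<And>n. \<pi> n \<in> Pi_mu \<mu>"
    and mirror: "\<And>n s. is_arg_min (mirror_objective P c \<gamma> \<mu> \<tau> \<eta> (\<pi> n) s) (\<lambda>m. m \<in> Prob) (\<pi> (Suc n) s)"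
  shows
    "let Vn = (\<lambda>n. V_stat P c \<gamma> \<mu> \<tau> (\<pi> n));
         Vs = V_opt P c \<gamma> \<mu> \<tau>;
         ps = pi_opt P c \<gamma> \<mu> \<tau>;
         d = occ_init P \<gamma> ps
     in
     (\<forall>\<rho>\<in>Prob. \<tau> \<le> \<eta> \<longrightarrow> (\<forall>n\<ge>1.
        0 \<le> eintegral \<rho> (Vn n) - eintegral \<rho> Vs \<and>
        eintegral \<rho> (Vn n) - eintegral \<rho> Vs
          \<le> ereal (1 / (1 - \<gamma>)) *
              (ereal \<eta> * eintegral (d \<rho>) (\<lambda>s. KL (ps s) (\<pi> 0 s))
               + eintegral (d \<rho>) (\<lambda>s. Vn 0 s - Vs s)) * ereal (1 / real n)))
     \<and>
     (\<forall>\<rho>\<in>Prob. \<forall>D. \<forall>\<xi>::real.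
        absolutely_continuous \<rho> (d \<rho>) \<longrightarrow>
        D \<in> Bb \<longrightarrow> (\<forall>s. 0 \<le> D s) \<longrightarrow> d \<rho> = density \<rho> (\<lambda>s. ennreal (D s)) \<longrightarrow>
        \<xi> = inverse (1 - \<gamma>) * sup_norm D \<longrightarrow>
        \<tau> \<le> \<eta> \<longrightarrow> \<eta> \<le> \<xi> * \<tau> \<longrightarrow> (\<forall>n.
          eintegral \<rho> (Vn n) - eintegral \<rho> Vs
            + ereal (\<eta> / ((1 - \<gamma>) * \<xi>)) * eintegral (d \<rho>) (\<lambda>s. KL (ps s) (\<pi> n s))
          \<le> ereal (((\<xi> - 1) / \<xi>) ^ n) *
              (eintegral \<rho> (Vn 0) - eintegral \<rho> Vs
               + ereal (\<eta> / ((1 - \<gamma>) * \<xi>)) * eintegral (d \<rho>) (\<lambda>s. KL (ps s) (\<pi> 0 s)))))"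
proof -
  interpret entropy_mdp P c \<gamma> \<tau> \<mu> by unfold_locales fact+
  obtain L where L: "\<And>n. L n \<in> log_densities" and \<pi>_L: "\<And>n. \<pi> n = pol (L n)"
    and L_Suc: "\<And>n. L (Suc n) = mirror_step \<eta> (L n)"
    by (rule mirror_descent_log_densities[of \<eta> \<pi>, OF \<eta> \<pi> mirror]) blast
  obtain w where w: "w \<in> Bb" and opt: "l_opt w \<in> log_densities"
    and V_opt: "V_opt P c \<gamma> \<mu> \<tau> = (\<lambda>s. ereal (w s))"
    and w_eq: "\<And>s. w s = avg (l_opt w) (\<lambda>x. Q w x + \<tau> * l_opt w x) s"
    and pi_opt: "pi_opt P c \<gamma> \<mu> \<tau> = pol (l_opt w)"
    by (rule optimal_exists) blast
  \<comment> \<open>\<open>w\<close> solves the Bellman equation of \<open>pol (l_opt w)\<close>, so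
    it is also the value of that policy.\<close>
  have val_opt: "val (l_opt w) = w"
    using V_stat_eqI[OF opt w w_eq] by (simp add: val_def fun_eq_iff)
  show ?thesis
    unfolding Let_def \<pi>_L pi_opt
  proof (intro conjI ballI allI impI, goal_cases)
    case (1 \<rho> n)
    interpret mirror_descent P c \<gamma> \<tau> \<mu> \<eta> L w \<rho> by unfold_locales (fact | use 1 in simp)+
    show ?case
      by (simp only: eintegral_gap ereal_less_eq zero_ereal_def gap_nonneg)
  next
    case (2 \<rho> n)
    interpret mirror_descent P c \<gamma> \<tau> \<mu> \<eta> L w \<rho> by unfold_locales (fact | use 2 in simp)+
    show ?case
      unfolding occ_opt_def[symmetric] eintegral_gap eintegral_divg eintegral_initial_gap
      using sublinear_rate[OF \<open>1 \<le> n\<close>] by simp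
  next
    case (3 \<rho> D \<xi> n)
    interpret mirror_descent P c \<gamma> \<tau> \<mu> \<eta> L w \<rho> by unfold_locales (fact | use 3 in simp)+
    have "occ_opt = density \<rho> (\<lambda>s. ennreal (D s))" using 3 by (simp only: occ_opt_def)
    from linear_rate[OF _ _ this, of \<xi> n] 3 show ?case
      unfolding occ_opt_def[symmetric] eintegral_gap eintegral_divg by simp
  qed
qed

end
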